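(* Let $k,l\in\{0,\ldots,n-1\}$ and let $M_0<M_1$ be real numbers. Suppose that for $j=0,1$ the problem $(P_{n,k}^{M_j})$ has a unique solution, with Green's function $g_{n,k}[M_j]$, and that hypothesis $\mathcal{H}_{k,l}(M)$ (defined in the context) holds for $M=M_0$ and $M=M_1$. Let $(t,s)\in(a,b)\times(a,b)$ be fixed (with $t\neq s$ in the case $l=n-1$ only). Suppose that one of the two following properties is fulfilled: (i) $\frac{\partial^l}{\partial t^l}g_{n,k}[M_0]$ and $\frac{\partial^k}{\partial t^k}g_{n,k}[M_1]$ are either both nonnegative or both nonpositive on $I\times I$; (ii) $\frac{\partial^l}{\partial t^l}g_{n,k}[M_1]$ and $\frac{\partial^k}{\partial t^k}g_{n,k}[M_0]$ are either both nonnegative or both nonpositive on $I\times I$. Then one of the three following properties holds: 1. $\frac{\partial^l}{\partial t^l}g_{n,k}[M_1](t,s)=\frac{\partial^l}{\partial t^l}g_{n,k}[M_0](t,s)=0$ if $t\in[a,s)$; 2. $\frac{\partial^l}{\partial t^l}g_{n,k}[M_1](t,s)=\frac{\partial^l}{\partial t^l}g_{n,k}[M_0](t,s)=0$ if $t\in(s,b]$; 3. $\frac{\partial^l}{\partial t^l}g_{n,k}[M_1](t,s)<\frac{\partial^l}{\partial t^l}g_{n,k}[M_0](t,s)$.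
   Context: Let $I=[a,b]$, $k\in\{0,\ldots,n-1\}$, $M\in\mathbb{R}$. Problem $(P_{n,k}^M)$ is: find $u\in C^n(I)$ with $T_{n,k}[M]u(t)=\sigma(t)$, $t\in I$, and $B_i(u)=0$, $i=1,\ldots,n$, where $T_{n,k}[M]u(t)=L_nu(t)+M\,u^{(k)}(t)$, $L_nu(t)=u^{(n)}(t)+a_1(t)u^{(n-1)}(t)+\cdots+a_n(t)u(t)$, $B_i(u)=\sum_{j=0}^{n-1}\bigl(\alpha^i_ju^{(j)}(a)+\beta^i_ju^{(j)}(b)\bigr)$, with real constants $\alpha^i_j,\beta^i_j$ and $\sigma,a_1,\ldots,a_n\in C(I)$. "$(P_{n,k}^M)$ has a unique solution" means that it has exactly one solution for every $\sigma\in C(I)$; this is equivalent to the homogeneous problem ($\sigma=0$) having only the trivial solution. The Green's function of $(P_{n,k}^M)$ is $g_{n,k}[M]\in C^{n-2}(I\times I)\cap C^n((I\times I)\setminus\{(t,t):t\in I\})$ which is, for each fixed $s\in(a,b)$, the unique solution of $T_{n,k}[M](g_{n,k}[M](t,s))=0$ for $t\in I\setminus\{s\}$, $B_i(g_{n,k}[M](\cdot,s))=0$, $i=1,\ldots,n$, and which satisfies: for each $t\in(a,b)$ the following lateral limits exist, are finite, and fulfil, with $h=\frac{\partial^{n-1}}{\partial t^{n-1}}g_{n,k}[M]$, $h(t^-,t)=h(t,t^+)$, $h(t,t^-)=h(t^+,t)$ and $h(t^+,t)-h(t^-,t)=h(t,t^-)-h(t,t^+)=1$, where $h(t^{\pm},t)=\lim_{r\to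 t^\pm}h(r,t)$ and $h(t,t^\pm)=\lim_{r\to t^\pm}h(t,r)$. If $(P_{n,k}^M)$ has a unique solution, that solution is $u(t)=\int_a^b g_{n,k}[M](t,s)\sigma(s)\,ds$. $\frac{\partial^m}{\partial t^m}$ denotes the $m$-th partial derivative in the first variable; sign conditions on derivatives of order $n-1$ are understood off the diagonal of $I\times I$. Hypothesis $\mathcal{H}_{k,l}(M)$: $a_j\in C^l(I)$ for all $j\in\{1,\ldots,n\}$, and either $l=0$, or $l\in\{1,\ldots,n-1\}$ and for each $r\in\{1,\ldots,l\}$ one of the following holds: (1) $b_{n,r-1}(t)=0$ for all $t\in I$; (2) $b_{n,r-1}(t)\neq0$ for all $t\in I$ and, either $\bigl(\frac{b_{n-1,r-1}}{b_{n,r-1}}\bigr)'(t)\neq-1$ for all $t\in I$, or $\bigl(\frac{b_{n-1,r-1}}{b_{n,r-1}}\bigr)'(t)=-1$ for all $t\in I$. Here the functions $b_{j,r}$ are defined recursively by: $a_0\equiv1$; $b_{j,0}=a_j$ for $j\in\{0,\ldots,n\}\setminus\{n-k\}$; $b_{n-k,0}=a_{n-k}+M$; $b_{0,r}\equiv1$ for $r\in\{1,\ldots,l\}$; and for $j\in\{1,\ldots,n\}$, $r\in\{1,\ldots,l\}$: $b_{j,r}=b_{j,r-1}+b_{j-1,r-1}'$ if $b_{n,r-1}\equiv0$ on $I$, and $b_{j,r}=b_{j,r-1}+b_{n,r-1}\bigl(\frac{b_{j-1,r-1}}{b_{n,r-1}}\bigr)'$ if $b_{n,r-1}(t)\neq0$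 for all $t\in I$.
   Formalization: Alternatives 1 and 2 are read at the fixed (t,s) and stated with t∈[a,s] and t∈[s,b] instead of [a,s) and (s,b], so for t=s (l<n-1) both derivatives may vanish; with the half-open intervals the claim fails, e.g. u''+Mu, u(a)=u'(a)=0. *)

theory Defs
  imports "HOL-Analysis.Analysis"
begin

text \<open>
  Derivatives of functions on a compact interval are taken within that interval, so they are
  one-sided at the endpoints. The value of a derivative is unspecified where the function is not
  differentiable. In particular a statement about \<open>nderiv S n f t\<close> at a point \<open>t\<close> depends only on
  the behaviour of \<open>f\<close> on \<open>S\<close> near \<open>t\<close>.
\<close>

definition deriv_in :: "real set \<Rightarrow> (real \<Rightarrow> real) \<Rightarrow> real \<Rightarrow> real" where
  "deriv_in S f t = vector_derivative f (at t within S)"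

definition nderiv :: "real set \<Rightarrow> nat \<Rightarrow> (real \<Rightarrow> real) \<Rightarrow> real \<Rightarrow> real" where
  "nderiv S j f = (deriv_in S ^^ j) f"

definition C_class :: "nat \<Rightarrow> real set \<Rightarrow> (real \<Rightarrow> real) \<Rightarrow> bool" where
  "C_class m S f \<longleftrightarrow>
     (\<forall>j<m. \<forall>t\<in>S. nderiv S j f differentiable (at t within S)) \<and>
     (\<forall>j\<le>m. continuous_on S (nderiv S j f))"

text \<open>
  The data are the interval \<open>[x0, x1]\<close>, the order \<open>n\<close>, the index \<open>k < n\<close>, the coefficients
  \<open>a j\<close> for \<open>1 \<le> j \<le> n\<close>, and the boundary constants \<open>\<alpha> i j\<close>, \<open>\<beta> i j\<close> for \<open>1 \<le> i \<le> n\<close>, \<open>j < n\<close>.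
  Values of \<open>a\<close>, \<open>\<alpha>\<close>, \<open>\<beta>\<close> at other indices are never used.
\<close>

definition L_op :: "real \<Rightarrow> real \<Rightarrow> nat \<Rightarrow> (nat \<Rightarrow> real \<Rightarrow> real) \<Rightarrow> (real \<Rightarrow> real) \<Rightarrow> real \<Rightarrow> real" where
  "L_op x0 x1 n a u t =
     nderiv {x0..x1} n u t + (\<Sum>j=1..n. a j t * nderiv {x0..x1} (n - j) u t)"

definition T_op ::
  "real \<Rightarrow> real \<Rightarrow> nat \<Rightarrow> nat \<Rightarrow> (nat \<Rightarrow> real \<Rightarrow> real) \<Rightarrow> real \<Rightarrow> (real \<Rightarrow> real) \<Rightarrow> real \<Rightarrow> real" where
  "T_op x0 x1 n k a M u t = L_op x0 x1 n a u t + M * nderiv {x0..x1} k u t"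

definition bdry ::
  "real \<Rightarrow> real \<Rightarrow> nat \<Rightarrow> (nat \<Rightarrow> nat \<Rightarrow> real) \<Rightarrow> (nat \<Rightarrow> nat \<Rightarrow> real) \<Rightarrow> nat \<Rightarrow> (real \<Rightarrow> real) \<Rightarrow> real" where
  "bdry x0 x1 n \<alpha> \<beta> i u =
     (\<Sum>j<n. \<alpha> i j * nderiv {x0..x1} j u x0 + \<beta> i j * nderiv {x0..x1} j u x1)"

definition bvp_solution ::
  "real \<Rightarrow> real \<Rightarrow> nat \<Rightarrow> nat \<Rightarrow> (nat \<Rightarrow> real \<Rightarrow> real) \<Rightarrow> (nat \<Rightarrow> nat \<Rightarrow> real) \<Rightarrow> (nat \<Rightarrow> nat \<Rightarrow> real) \<Rightarrow>
   real \<Rightarrow> (real \<Rightarrow> real) \<Rightarrow> (real \<Rightarrow> real) \<Rightarrow> bool" where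
  "bvp_solution x0 x1 n k a \<alpha> \<beta> M \<sigma> u \<longleftrightarrow>
     C_class n {x0..x1} u \<and>
     (\<forall>t\<in>{x0..x1}. T_op x0 x1 n k a M u t = \<sigma> t) \<and>
     (\<forall>i\<in>{1..n}. bdry x0 x1 n \<alpha> \<beta> i u = 0)"

definition bvp_unique ::
  "real \<Rightarrow> real \<Rightarrow> nat \<Rightarrow> nat \<Rightarrow> (nat \<Rightarrow> real \<Rightarrow> real) \<Rightarrow> (nat \<Rightarrow> nat \<Rightarrow> real) \<Rightarrow> (nat \<Rightarrow> nat \<Rightarrow> real) \<Rightarrow>
   real \<Rightarrow> bool" where
  "bvp_unique x0 x1 n k a \<alpha> \<beta> M \<longleftrightarrow>
     (\<forall>\<sigma>. continuous_on {x0..x1} \<sigma> \<longrightarrow>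
        (\<exists>u. bvp_solution x0 x1 n k a \<alpha> \<beta> M \<sigma> u \<and>
             (\<forall>v. bvp_solution x0 x1 n k a \<alpha> \<beta> M \<sigma> v \<longrightarrow> (\<forall>t\<in>{x0..x1}. v t = u t))))"

definition pderiv_t :: "real \<Rightarrow> real \<Rightarrow> nat \<Rightarrow> (real \<Rightarrow> real \<Rightarrow> real) \<Rightarrow> real \<Rightarrow> real \<Rightarrow> real" where
  "pderiv_t x0 x1 m g t s = nderiv {x0..x1} m (\<lambda>r. g r s) t"

text \<open>
  The regularity \<open>C\<^sup>n\<^sup>-\<^sup>2(I \<times> I) \<inter> C\<^sup>n((I \<times> I) - diagonal)\<close> of a Green's function refers to its
  derivatives in \<open>t\<close>, required to be jointly continuous in \<open>(t, s)\<close>. (For coefficients that are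
  merely continuous, a Green's function need not have higher derivatives in \<open>s\<close>.) For \<open>n = 1\<close>
  nothing is required on the diagonal. That \<open>g (\<cdot>, s)\<close> is the only function with these properties
  is a consequence of the unique solvability of the problem and is not part of the definition.
\<close>

definition is_green ::
  "real \<Rightarrow> real \<Rightarrow> nat \<Rightarrow> nat \<Rightarrow> (nat \<Rightarrow> real \<Rightarrow> real) \<Rightarrow> (nat \<Rightarrow> nat \<Rightarrow> real) \<Rightarrow> (nat \<Rightarrow> nat \<Rightarrow> real) \<Rightarrow>
   real \<Rightarrow> (real \<Rightarrow> real \<Rightarrow> real) \<Rightarrow> bool" where
  "is_green x0 x1 n k a \<alpha> \<beta> M g \<longleftrightarrow>
     (\<forall>j. j + 2 < n \<longrightarrow> (\<forall>t\<in>{x0..x1}. \<forall>s\<in>{x0..x1}.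
        (\<lambda>r. pderiv_t x0 x1 j g r s) differentiable (at t within {x0..x1}))) \<and>
     (\<forall>j. j + 2 \<le> n \<longrightarrow>
        continuous_on ({x0..x1} \<times> {x0..x1}) (\<lambda>(t, s). pderiv_t x0 x1 j g t s)) \<and>
     (\<forall>j<n. \<forall>t\<in>{x0..x1}. \<forall>s\<in>{x0..x1}. t \<noteq> s \<longrightarrow>
        (\<lambda>r. pderiv_t x0 x1 j g r s) differentiable (at t within {x0..x1})) \<and>
     (\<forall>j\<le>n. continuous_on {(t, s). t \<in> {x0..x1} \<and> s \<in> {x0..x1} \<and> t \<noteq> s}
        (\<lambda>(t, s). pderiv_t x0 x1 j g t s)) \<and>
     (\<forall>s\<in>{x0<..<x1}.
        (\<forall>t\<in>{x0..x1} - {s}. T_op x0 x1 n k a M (\<lambda>r. g r s) t = 0) \<and>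
        (\<forall>i\<in>{1..n}. bdry x0 x1 n \<alpha> \<beta> i (\<lambda>r. g r s) = 0)) \<and>
     (\<forall>t\<in>{x0<..<x1}. \<exists>p q.
        ((\<lambda>r. pderiv_t x0 x1 (n - 1) g r t) \<longlongrightarrow> p) (at_left t) \<and>
        ((\<lambda>r. pderiv_t x0 x1 (n - 1) g t r) \<longlongrightarrow> p) (at_right t) \<and>
        ((\<lambda>r. pderiv_t x0 x1 (n - 1) g t r) \<longlongrightarrow> q) (at_left t) \<and>
        ((\<lambda>r. pderiv_t x0 x1 (n - 1) g r t) \<longlongrightarrow> q) (at_right t) \<and>
        q - p = 1)"

text \<open>
  \<open>b_coef \<dots> r j\<close> is \<open>b\<^bsub>j,r\<^esub>\<close>. If \<open>b\<^bsub>n,r\<^esub>\<close> is neither identically zero nor nowhere zero, then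
  \<open>b\<^bsub>j,r+1\<^esub>\<close> has no meaning; the second branch below then applies, but \<open>hyp_H\<close> excludes this case.
\<close>

primrec b_coef ::
  "real \<Rightarrow> real \<Rightarrow> nat \<Rightarrow> nat \<Rightarrow> (nat \<Rightarrow> real \<Rightarrow> real) \<Rightarrow> real \<Rightarrow> nat \<Rightarrow> nat \<Rightarrow> real \<Rightarrow> real" where
  "b_coef x0 x1 n k a M 0 =
     (\<lambda>j t. (if j = 0 then 1 else a j t) + (if j = n - k then M else 0))"
| "b_coef x0 x1 n k a M (Suc r) =
     (\<lambda>j t.
        if j = 0 then 1
        else if \<forall>x\<in>{x0..x1}. b_coef x0 x1 n k a M r n x = 0
        then b_coef x0 x1 n k a M r j t
             + deriv_in {x0..x1} (b_coef x0 x1 n k a M r (j - 1)) t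
        else b_coef x0 x1 n k a M r j t
             + b_coef x0 x1 n k a M r n t *
               deriv_in {x0..x1}
                 (\<lambda>x. b_coef x0 x1 n k a M r (j - 1) x / b_coef x0 x1 n k a M r n x) t)"

definition hyp_H ::
  "real \<Rightarrow> real \<Rightarrow> nat \<Rightarrow> nat \<Rightarrow> nat \<Rightarrow> (nat \<Rightarrow> real \<Rightarrow> real) \<Rightarrow> real \<Rightarrow> bool" where
  "hyp_H x0 x1 n k l a M \<longleftrightarrow>
     (\<forall>j\<in>{1..n}. C_class l {x0..x1} (a j)) \<and>
     (l = 0 \<or>
      l \<in> {1..n-1} \<and>
      (\<forall>r\<in>{1..l}.
         (let b = b_coef x0 x1 n k a M (r - 1);
              d = deriv_in {x0..x1} (\<lambda>x. b (n - 1) x / b n x)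
          in (\<forall>t\<in>{x0..x1}. b n t = 0) \<or>
             ((\<forall>t\<in>{x0..x1}. b n t \<noteq> 0) \<and>
              ((\<forall>t\<in>{x0..x1}. d t \<noteq> -1) \<or> (\<forall>t\<in>{x0..x1}. d t = -1))))))"

text \<open>
  Sign conditions on \<open>I \<times> I\<close> for the \<open>m\<close>-th derivative in \<open>t\<close>; derivatives of order \<open>n - 1\<close> do not
  exist on the diagonal, which is therefore left out.
\<close>

definition pderiv_nonneg ::
  "real \<Rightarrow> real \<Rightarrow> nat \<Rightarrow> nat \<Rightarrow> (real \<Rightarrow> real \<Rightarrow> real) \<Rightarrow> bool" where
  "pderiv_nonneg x0 x1 n m g \<longleftrightarrow>
     (\<forall>t\<in>{x0..x1}. \<forall>s\<in>{x0..x1}. (m = n - 1 \<longrightarrow> t \<noteq> s) \<longrightarrow> 0 \<le> pderiv_t x0 x1 m g t s)"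

definition pderiv_nonpos ::
  "real \<Rightarrow> real \<Rightarrow> nat \<Rightarrow> nat \<Rightarrow> (real \<Rightarrow> real \<Rightarrow> real) \<Rightarrow> bool" where
  "pderiv_nonpos x0 x1 n m g \<longleftrightarrow>
     (\<forall>t\<in>{x0..x1}. \<forall>s\<in>{x0..x1}. (m = n - 1 \<longrightarrow> t \<noteq> s) \<longrightarrow> pderiv_t x0 x1 m g t s \<le> 0)"

end

theory Submission
  imports Defs
begin

text \<open>
  Write \<open>D\<^sup>m\<close> for the \<open>m\<close>-th derivative in the first variable. Off the diagonal \<open>g (\<cdot>, s)\<close> and
  \<open>g' (\<cdot>, s)\<close>, the Green's functions for \<open>M\<close> and \<open>M'\<close>, solve equations that differ only by the
  term of order \<open>k\<close>, and they jump in the same way at \<open>s\<close>. So their difference solves, without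
  any jump, the boundary value problem for \<open>M\<close> with right-hand side \<open>(M - M') * D\<^sup>k g' (\<cdot>, s)\<close>,
  and therefore
  \<open>D\<^sup>l g' (t, s) - D\<^sup>l g (t, s) = (M - M') * (\<integral>r. D\<^sup>l g (t, r) * D\<^sup>k g' (r, s))\<close>
  (lemma \<open>representation\<close>). The sign conditions say that the integrand is nonnegative, once with
  \<open>(M, M') = (M0, M1)\<close> and once with the roles exchanged; in both cases \<open>D\<^sup>l g1 \<le> D\<^sup>l g0\<close> follows.

  Equality forces the integrand to vanish wherever it is continuous. If \<open>D\<^sup>l g (t, s)\<close> were not
  zero, then \<open>D\<^sup>l g (t, r)\<close> would not be zero for \<open>r\<close> near \<open>s\<close>, so \<open>D\<^sup>k g' (\<cdot>, s)\<close> would vanish on both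
  sides of \<open>s\<close>, and with it \<open>D\<^sup>n\<^sup>-\<^sup>1 g' (\<cdot>, s)\<close>, which contradicts its unit jump
  (lemmas \<open>D'_not_locally_zero\<close> and \<open>overlap_sign\<close>). Hence \<open>D\<^sup>l g (t, s) = 0\<close>, and by equality both
  derivatives are zero.

  The representation needs that integration against \<open>g\<close> solves the boundary value problem. This
  is shown in integrated form: every \<open>D\<^sup>j g (\<cdot>, r)\<close> with \<open>j < n\<close> is, up to the jump, a primitive
  of the next derivative; multiplying by the right-hand side, integrating over \<open>r\<close> and exchanging
  the integrals gives the same relation for the integral operators, the jump contributing the
  right-hand side (lemma \<open>U_has_integral\<close>). The exchange requires \<open>D\<^sup>n\<^sup>-\<^sup>1 g\<close> to be bounded up to
  the diagonal, corners included, which is obtained from the differential equation by a Gronwall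
  estimate (lemmas \<open>top_D_comparison\<close> and \<open>D_bounded\<close>).
\<close>

section \<open>Calculus on an interval\<close>

lemma nderiv_Suc: "nderiv S (Suc j) f = deriv_in S (nderiv S j f)"
  by (simp add: nderiv_def)

lemma nderiv_0: "nderiv S 0 f = f"
  by (simp add: nderiv_def)

lemma deriv_in_eq:
  assumes "x0 < x1" "t \<in> {x0..x1}" "(f has_vector_derivative d) (at t within {x0..x1})"
  shows "deriv_in {x0..x1} f t = d"
  using vector_derivative_within_cbox[of x0 x1 t f d] assms by (simp add: deriv_in_def)

text \<open>
  A Gronwall estimate in both directions of time. Passing from \<open>h\<close> to \<open>h\<^sup>2 + 1\<close> makes the
  inhomogeneous inequality homogeneous, because \<open>2 * \<bar>h\<bar> \<le> h\<^sup>2 + 1\<close>, and keeps everything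
  differentiable.
\<close>

lemma growth_bound:
  fixes h h' :: "real \<Rightarrow> real"
  assumes "u \<le> v" "continuous_on {u..v} h"
    and der: "\<And>x. u < x \<Longrightarrow> x < v \<Longrightarrow> (h has_real_derivative h' x) (at x)"
    and bound: "\<And>x. u < x \<Longrightarrow> x < v \<Longrightarrow> \<bar>h' x\<bar> \<le> L * \<bar>h x\<bar> + C"
    and "0 \<le> C" "0 \<le> L"
  shows "(h v)\<^sup>2 + 1 \<le> exp ((2 * L + C) * (v - u)) * ((h u)\<^sup>2 + 1)"
    and "(h u)\<^sup>2 + 1 \<le> exp ((2 * L + C) * (v - u)) * ((h v)\<^sup>2 + 1)"
proof -
  define c where "c = 2 * L + C"
  have key: "\<bar>2 * h x * h' x\<bar> \<le> c * ((h x)\<^sup>2 + 1)" if "u < x" "x < v" for x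
  proof -
    have "\<bar>2 * h x * h' x\<bar> = 2 * \<bar>h x\<bar> * \<bar>h' x\<bar>"
      by (simp add: abs_mult)
    also have "\<dots> \<le> 2 * \<bar>h x\<bar> * (L * \<bar>h x\<bar> + C)"
      using bound that by (intro mult_left_mono) auto
    also have "\<dots> = 2 * L * (h x)\<^sup>2 + C * (2 * \<bar>h x\<bar>)"
      by (simp add: algebra_simps power2_eq_square)
    also have "\<dots> \<le> 2 * L * ((h x)\<^sup>2 + 1) + C * ((h x)\<^sup>2 + 1)"
    proof -
      have "0 \<le> (\<bar>h x\<bar> - 1)\<^sup>2"
        by simp
      then have "2 * \<bar>h x\<bar> \<le> (h x)\<^sup>2 + 1"
        by (simp add: power2_diff)
      then show ?thesis
        using \<open>0 \<le> C\<close> \<open>0 \<le> L\<close> by (intro add_mono mult_left_mono) auto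
    qed
    finally show ?thesis
      by (simp add: c_def algebra_simps)
  qed
  have expmul: "exp x * (exp y * z) = exp (x + y) * z" for x y z :: real
    by (simp add: exp_add)
  have args: "c * v + - c * v = 0" "c * v + - c * u = c * (v - u)"
    "- c * u + c * u = 0" "- c * u + c * v = c * (v - u)"
    by (simp_all add: algebra_simps)
  have "exp (- c * v) * ((h v)\<^sup>2 + 1) \<le> exp (- c * u) * ((h u)\<^sup>2 + 1)"
  proof (rule DERIV_nonpos_imp_decreasing_open[OF \<open>u \<le> v\<close>])
    fix x assume x: "u < x" "x < v"
    have "((\<lambda>x. exp (- c * x) * ((h x)\<^sup>2 + 1)) has_real_derivative
        exp (- c * x) * (2 * h x * h' x - c * ((h x)\<^sup>2 + 1))) (at x)"
      by (auto intro!: derivative_eq_intros der[OF x] simp: algebra_simps)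
    moreover have "exp (- c * x) * (2 * h x * h' x - c * ((h x)\<^sup>2 + 1)) \<le> 0"
      using key[OF x] by (intro mult_nonneg_nonpos) auto
    ultimately show "\<exists>y. ((\<lambda>x. exp (- c * x) * ((h x)\<^sup>2 + 1)) has_real_derivative y) (at x) \<and> y \<le> 0"
      by blast
  qed (intro continuous_intros assms)
  then have "exp (c * v) * (exp (- c * v) * ((h v)\<^sup>2 + 1))
      \<le> exp (c * v) * (exp (- c * u) * ((h u)\<^sup>2 + 1))"
    by (rule mult_left_mono) simp
  then show "(h v)\<^sup>2 + 1 \<le> exp ((2 * L + C) * (v - u)) * ((h u)\<^sup>2 + 1)"
    unfolding expmul args by (simp add: c_def)
  have "exp (c * u) * ((h u)\<^sup>2 + 1) \<le> exp (c * v) * ((h v)\<^sup>2 + 1)"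
  proof (rule DERIV_nonneg_imp_increasing_open[OF \<open>u \<le> v\<close>])
    fix x assume x: "u < x" "x < v"
    have "((\<lambda>x. exp (c * x) * ((h x)\<^sup>2 + 1)) has_real_derivative
        exp (c * x) * (2 * h x * h' x + c * ((h x)\<^sup>2 + 1))) (at x)"
      by (auto intro!: derivative_eq_intros der[OF x] simp: algebra_simps)
    moreover have "0 \<le> exp (c * x) * (2 * h x * h' x + c * ((h x)\<^sup>2 + 1))"
      using key[OF x] by (intro mult_nonneg_nonneg) auto
    ultimately show "\<exists>y. ((\<lambda>x. exp (c * x) * ((h x)\<^sup>2 + 1)) has_real_derivative y) (at x) \<and> 0 \<le> y"
      by blast
  qed (intro continuous_intros assms)
  then have "exp (- c * u) * (exp (c * u) * ((h u)\<^sup>2 + 1))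
      \<le> exp (- c * u) * (exp (c * v) * ((h v)\<^sup>2 + 1))"
    by (rule mult_left_mono) simp
  then show "(h u)\<^sup>2 + 1 \<le> exp ((2 * L + C) * (v - u)) * ((h v)\<^sup>2 + 1)"
    unfolding expmul args by (simp add: c_def)
qed

section \<open>A Green's function and its derivatives off the diagonal\<close>

text \<open>
  The equation \<open>T u = 0\<close> solved for the highest derivative: \<open>w j\<close> stands for the value at \<open>t\<close> of
  the \<open>j\<close>-th derivative.
\<close>

definition jet_rhs ::
  "nat \<Rightarrow> nat \<Rightarrow> (nat \<Rightarrow> real \<Rightarrow> real) \<Rightarrow> real \<Rightarrow> real \<Rightarrow> (nat \<Rightarrow> real) \<Rightarrow> real" where
  "jet_rhs n k a M t w = - (\<Sum>j=1..n. a j t * w (n - j)) - M * w k"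

lemma T_op_eq_0_iff:
  "T_op x0 x1 n k a M u t = 0 \<longleftrightarrow>
     nderiv {x0..x1} n u t = jet_rhs n k a M t (\<lambda>j. nderiv {x0..x1} j u t)"
  by (auto simp: T_op_def L_op_def jet_rhs_def)

locale green_function =
  fixes x0 x1 :: real and n k :: nat and a :: "nat \<Rightarrow> real \<Rightarrow> real"
    and \<alpha> \<beta> :: "nat \<Rightarrow> nat \<Rightarrow> real" and M :: real and g :: "real \<Rightarrow> real \<Rightarrow> real"
  assumes ivl: "x0 < x1"
    and coef_cont: "\<And>j. j \<in> {1..n} \<Longrightarrow> continuous_on {x0..x1} (a j)"
    and k_less: "k < n"
    and green: "is_green x0 x1 n k a \<alpha> \<beta> M g"
begin

abbreviation I :: "real set" where "I \<equiv> {x0..x1}"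

abbreviation D :: "nat \<Rightarrow> real \<Rightarrow> real \<Rightarrow> real" where "D j t s \<equiv> pderiv_t x0 x1 j g t s"

lemma D_deriv:
  assumes "j < n" "t \<in> I" "s \<in> I" "t \<noteq> s"
  shows "((\<lambda>r. D j r s) has_vector_derivative D (Suc j) t s) (at t within I)"
proof -
  have "(\<lambda>r. D j r s) differentiable (at t within I)"
    using green assms by (simp add: is_green_def)
  then show ?thesis
    by (simp add: vector_derivative_works pderiv_t_def nderiv_Suc deriv_in_def)
qed

lemma D_deriv_interior:
  assumes "j < n" "x0 < t" "t < x1" "s \<in> I" "t \<noteq> s"
  shows "((\<lambda>r. D j r s) has_real_derivative D (Suc j) t s) (at t)"
  using D_deriv[of j t s] assms
  by (simp add: at_within_Icc_at has_real_derivative_iff_has_vector_derivative)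

lemma D_cont_pair_off:
  assumes "j \<le> n"
  shows "continuous_on {(t, s). t \<in> I \<and> s \<in> I \<and> t \<noteq> s} (\<lambda>(t, s). D j t s)"
  using green assms by (simp add: is_green_def)

lemma D_cont_pair:
  assumes "j + 2 \<le> n"
  shows "continuous_on (I \<times> I) (\<lambda>(t, s). D j t s)"
  using green assms by (simp add: is_green_def)

lemma D_cont_fst_off:
  assumes "j \<le> n" "s \<in> I" "A \<subseteq> I - {s}"
  shows "continuous_on A (\<lambda>t. D j t s)"
proof -
  have "continuous_on A (\<lambda>t. (\<lambda>(t, s). D j t s) (t, s))"
    by (rule continuous_on_compose2[OF D_cont_pair_off[OF \<open>j \<le> n\<close>]])
      (use assms in \<open>auto intro!: continuous_on_Pair continuous_on_id continuous_on_const\<close>)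
  then show ?thesis
    by simp
qed

lemma D_cont_snd_off:
  assumes "j \<le> n" "t \<in> I" "A \<subseteq> I - {t}"
  shows "continuous_on A (\<lambda>s. D j t s)"
proof -
  have "continuous_on A (\<lambda>s. (\<lambda>(t, s). D j t s) (t, s))"
    by (rule continuous_on_compose2[OF D_cont_pair_off[OF \<open>j \<le> n\<close>]])
      (use assms in \<open>auto intro!: continuous_on_Pair continuous_on_id continuous_on_const\<close>)
  then show ?thesis
    by simp
qed

lemma D_cont_fst:
  assumes "j + 2 \<le> n" "s \<in> I"
  shows "continuous_on I (\<lambda>t. D j t s)"
proof -
  have "continuous_on I (\<lambda>t. (\<lambda>(t, s). D j t s) (t, s))"
    by (rule continuous_on_compose2[OF D_cont_pair[OF \<open>j + 2 \<le> n\<close>]])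
      (use assms in \<open>auto intro!: continuous_on_Pair continuous_on_id continuous_on_const\<close>)
  then show ?thesis
    by simp
qed

lemma D_cont_snd:
  assumes "j + 2 \<le> n" "t \<in> I"
  shows "continuous_on I (\<lambda>s. D j t s)"
proof -
  have "continuous_on I (\<lambda>s. (\<lambda>(t, s). D j t s) (t, s))"
    by (rule continuous_on_compose2[OF D_cont_pair[OF \<open>j + 2 \<le> n\<close>]])
      (use assms in \<open>auto intro!: continuous_on_Pair continuous_on_id continuous_on_const\<close>)
  then show ?thesis
    by simp
qed

lemma D_ode:
  assumes "s \<in> {x0<..<x1}" "t \<in> I" "t \<noteq> s"
  shows "D n t s = jet_rhs n k a M t (\<lambda>j. D j t s)"
proof -
  have "T_op x0 x1 n k a M (\<lambda>r. g r s) t = 0"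
    using green assms by (simp add: is_green_def)
  then show ?thesis
    by (simp add: T_op_eq_0_iff pderiv_t_def)
qed

lemma D_bdry:
  assumes "s \<in> {x0<..<x1}" "i \<in> {1..n}"
  shows "(\<Sum>j<n. \<alpha> i j * D j x0 s + \<beta> i j * D j x1 s) = 0"
proof -
  have "bdry x0 x1 n \<alpha> \<beta> i (\<lambda>r. g r s) = 0"
    using green assms by (simp add: is_green_def)
  then show ?thesis
    by (simp add: bdry_def pderiv_t_def)
qed

lemma D_jump:
  assumes "s \<in> {x0<..<x1}"
  obtains p where "((\<lambda>r. D (n - 1) r s) \<longlongrightarrow> p) (at_left s)"
    "((\<lambda>r. D (n - 1) r s) \<longlongrightarrow> p + 1) (at_right s)"
proof -
  obtain p q where pq: "((\<lambda>r. D (n - 1) r s) \<longlongrightarrow> p) (at_left s)"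
    "((\<lambda>r. D (n - 1) r s) \<longlongrightarrow> q) (at_right s)" "q - p = 1"
    using green[unfolded is_green_def, THEN conjunct2, THEN conjunct2, THEN conjunct2,
        THEN conjunct2, THEN conjunct2] assms by blast
  then have "q = p + 1"
    by linarith
  then show ?thesis
    using that[of p] pq by metis
qed

subsection \<open>Boundedness\<close>

lemma D_bounded_low: "\<exists>B. \<forall>j. j + 2 \<le> n \<longrightarrow> (\<forall>t\<in>I. \<forall>s\<in>I. \<bar>D j t s\<bar> \<le> B)"
proof -
  have "\<exists>B. \<forall>t\<in>I. \<forall>s\<in>I. \<bar>D j t s\<bar> \<le> B" if "j + 2 \<le> n" for j
  proof -
    have "bounded ((\<lambda>(t, s). D j t s) ` (I \<times> I))"
      by (intro compact_imp_bounded compact_continuous_image D_cont_pair that compact_Times) auto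
    then show ?thesis
      unfolding bounded_iff by fastforce
  qed
  then obtain B where B: "\<And>j t s. j + 2 \<le> n \<Longrightarrow> t \<in> I \<Longrightarrow> s \<in> I \<Longrightarrow> \<bar>D j t s\<bar> \<le> B j"
    by metis
  have "\<bar>D j t s\<bar> \<le> (\<Sum>i<n. \<bar>B i\<bar>)" if "j + 2 \<le> n" "t \<in> I" "s \<in> I" for j t s
  proof -
    have "\<bar>D j t s\<bar> \<le> \<bar>B j\<bar>"
      using B[OF that] by simp
    also have "\<dots> \<le> (\<Sum>i<n. \<bar>B i\<bar>)"
      using that by (intro member_le_sum) auto
    finally show ?thesis .
  qed
  then show ?thesis
    by blast
qed

lemma coef_bounded: "\<exists>A\<ge>0. \<forall>j\<in>{1..n}. \<forall>t\<in>I. \<bar>a j t\<bar> \<le> A"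
proof -
  have "\<exists>B. \<forall>t\<in>I. \<bar>a j t\<bar> \<le> B" if "j \<in> {1..n}" for j
  proof -
    have "bounded (a j ` I)"
      by (intro compact_imp_bounded compact_continuous_image coef_cont that) auto
    then show ?thesis
      unfolding bounded_iff by fastforce
  qed
  then obtain B where B: "\<And>j t. j \<in> {1..n} \<Longrightarrow> t \<in> I \<Longrightarrow> \<bar>a j t\<bar> \<le> B j"
    by metis
  have "\<bar>a j t\<bar> \<le> (\<Sum>i=1..n. \<bar>B i\<bar>)" if "j \<in> {1..n}" "t \<in> I" for j t
  proof -
    have "\<bar>a j t\<bar> \<le> \<bar>B j\<bar>"
      using B[OF that] by simp
    also have "\<dots> \<le> (\<Sum>i=1..n. \<bar>B i\<bar>)"
      using that by (intro member_le_sum) auto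
    finally show ?thesis .
  qed
  moreover have "0 \<le> (\<Sum>i=1..n. \<bar>B i\<bar>)"
    by (simp add: sum_nonneg)
  ultimately show ?thesis
    by blast
qed

lemma jet_rhs_bounded:
  "\<exists>K\<ge>0. \<forall>t\<in>I. \<forall>w b. (\<forall>j<n. \<bar>w j\<bar> \<le> b) \<longrightarrow> \<bar>jet_rhs n k a M t w\<bar> \<le> K * b"
proof -
  obtain A where A: "0 \<le> A" "\<And>j t. j \<in> {1..n} \<Longrightarrow> t \<in> I \<Longrightarrow> \<bar>a j t\<bar> \<le> A"
    using coef_bounded by blast
  have "\<bar>jet_rhs n k a M t w\<bar> \<le> (real n * A + \<bar>M\<bar>) * b" if t: "t \<in> I" and w: "\<forall>j<n. \<bar>w j\<bar> \<le> b" for t w b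
  proof -
    have "\<bar>jet_rhs n k a M t w\<bar> \<le> \<bar>\<Sum>j=1..n. a j t * w (n - j)\<bar> + \<bar>M * w k\<bar>"
      unfolding jet_rhs_def by linarith
    also have "\<bar>\<Sum>j=1..n. a j t * w (n - j)\<bar> \<le> (\<Sum>j=1..n. A * b)"
      using A t w by (intro order_trans[OF sum_abs] sum_mono) (auto simp: abs_mult intro!: mult_mono)
    also have "\<bar>M * w k\<bar> \<le> \<bar>M\<bar> * b"
      using w k_less by (auto simp: abs_mult intro!: mult_left_mono)
    finally show ?thesis
      by (simp add: algebra_simps)
  qed
  moreover have "0 \<le> real n * A + \<bar>M\<bar>"
    using A by simp
  ultimately show ?thesis
    by blast
qed

text \<open>
  For fixed \<open>s\<close> the derivative of order \<open>n - 1\<close> solves a first-order equation with bounded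
  coefficients on either side of \<open>s\<close>, and its values on the two sides are linked by the unit jump.
  So its size anywhere controls its size everywhere, uniformly in \<open>s\<close>.
\<close>

lemma top_D_comparison:
  "\<exists>E>0. \<forall>s\<in>{x0<..<x1}. \<forall>t\<in>I - {s}. \<forall>t0\<in>I - {s}.
     (D (n - 1) t s)\<^sup>2 + 1 \<le> E * ((D (n - 1) t0 s)\<^sup>2 + 1)"
proof -
  obtain B where B: "\<And>j t s. j + 2 \<le> n \<Longrightarrow> t \<in> I \<Longrightarrow> s \<in> I \<Longrightarrow> \<bar>D j t s\<bar> \<le> B"
    using D_bounded_low by blast
  obtain K where K: "0 \<le> K"
    "\<And>t w b. t \<in> I \<Longrightarrow> (\<And>j. j < n \<Longrightarrow> \<bar>w j\<bar> \<le> b) \<Longrightarrow> \<bar>jet_rhs n k a M t w\<bar> \<le> K * b"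
    using jet_rhs_bounded by blast
  define C where "C = K * \<bar>B\<bar>"
  define F where "F = exp ((2 * K + C) * (x1 - x0))"
  have C: "0 \<le> C"
    using K by (simp add: C_def)
  have F: "1 \<le> F"
    using K C ivl by (simp add: F_def)
  have n: "0 < n" "Suc (n - 1) = n"
    using k_less by auto
  have deriv_bound: "\<bar>D n t s\<bar> \<le> K * \<bar>D (n - 1) t s\<bar> + C"
    if "s \<in> {x0<..<x1}" "t \<in> I" "t \<noteq> s" for s t
  proof -
    have "\<bar>D j t s\<bar> \<le> \<bar>D (n - 1) t s\<bar> + \<bar>B\<bar>" if "j < n" for j
    proof (cases "j = n - 1")
      case False
      then have "j + 2 \<le> n"
        using that by simp
      then show ?thesis
        using B[of j t s] \<open>s \<in> _\<close> \<open>t \<in> I\<close> by auto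
    qed simp
    then have "\<bar>D n t s\<bar> \<le> K * (\<bar>D (n - 1) t s\<bar> + \<bar>B\<bar>)"
      using K(2)[of t "\<lambda>j. D j t s"] that by (simp add: D_ode)
    then show ?thesis
      by (simp add: C_def algebra_simps)
  qed
  have one_side: "(D (n - 1) t s)\<^sup>2 + 1 \<le> F * ((D (n - 1) t' s)\<^sup>2 + 1)"
    if s: "s \<in> {x0<..<x1}" and t: "t \<in> I" "t' \<in> I" and side: "t < s \<and> t' < s \<or> s < t \<and> s < t'"
    for s t t'
  proof -
    define u v where "u = min t t'" and "v = max t t'"
    have uv: "u \<le> v" "{u..v} \<subseteq> I - {s}" "s \<in> I"
      using s t side by (auto simp: u_def v_def)
    have gb: "(D (n - 1) v s)\<^sup>2 + 1 \<le> exp ((2 * K + C) * (v - u)) * ((D (n - 1) u s)\<^sup>2 + 1)"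
      "(D (n - 1) u s)\<^sup>2 + 1 \<le> exp ((2 * K + C) * (v - u)) * ((D (n - 1) v s)\<^sup>2 + 1)"
    proof -
      have cont: "continuous_on {u..v} (\<lambda>r. D (n - 1) r s)"
        using uv by (intro D_cont_fst_off) auto
      have inside: "x0 < x" "x < x1" "x \<noteq> s" if "u < x" "x < v" for x
        using that s t side by (auto simp: u_def v_def)
      have der: "((\<lambda>r. D (n - 1) r s) has_real_derivative D n x s) (at x)"
        if "u < x" "x < v" for x
        using D_deriv_interior[of "n - 1" x s] inside[OF that] uv n by simp
      have bnd: "\<bar>D n x s\<bar> \<le> K * \<bar>D (n - 1) x s\<bar> + C" if "u < x" "x < v" for x
        using inside[OF that] s by (intro deriv_bound) auto
      show "(D (n - 1) v s)\<^sup>2 + 1 \<le> exp ((2 * K + C) * (v - u)) * ((D (n - 1) u s)\<^sup>2 + 1)"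
        "(D (n - 1) u s)\<^sup>2 + 1 \<le> exp ((2 * K + C) * (v - u)) * ((D (n - 1) v s)\<^sup>2 + 1)"
        using growth_bound[OF uv(1) cont der bnd C K(1)] by auto
    qed
    have "exp ((2 * K + C) * (v - u)) \<le> F"
      unfolding F_def using K C t by (auto simp: u_def v_def intro!: mult_left_mono)
    then have "exp ((2 * K + C) * (v - u)) * (c\<^sup>2 + 1) \<le> F * (c\<^sup>2 + 1)" for c
      by (intro mult_right_mono) auto
    then have "(D (n - 1) v s)\<^sup>2 + 1 \<le> F * ((D (n - 1) u s)\<^sup>2 + 1)"
      "(D (n - 1) u s)\<^sup>2 + 1 \<le> F * ((D (n - 1) v s)\<^sup>2 + 1)"
      using gb order_trans by blast+
    then show ?thesis
      by (cases "t \<le> t'") (auto simp: u_def v_def min_def max_def split: if_splits)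
  qed
  have "(D (n - 1) t s)\<^sup>2 + 1 \<le> 3 * F\<^sup>2 * ((D (n - 1) t0 s)\<^sup>2 + 1)"
    if s: "s \<in> {x0<..<x1}" and t: "t \<in> I - {s}" "t0 \<in> I - {s}" for s t t0
  proof -
    obtain p where p: "((\<lambda>r. D (n - 1) r s) \<longlongrightarrow> p) (at_left s)"
      "((\<lambda>r. D (n - 1) r s) \<longlongrightarrow> p + 1) (at_right s)"
      using D_jump[OF s] .
    have ev: "eventually (\<lambda>r. r \<in> I \<and> r < s) (at_left s)" "eventually (\<lambda>r. r \<in> I \<and> s < r) (at_right s)"
      using s eventually_at_left_real[of x0 s] eventually_at_right_real[of s x1]
      by (auto elim: eventually_mono)
    have left: "p\<^sup>2 + 1 \<le> F * ((D (n - 1) r s)\<^sup>2 + 1)" "(D (n - 1) r s)\<^sup>2 + 1 \<le> F * (p\<^sup>2 + 1)"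
      if r: "r \<in> I" "r < s" for r
    proof -
      have *: "((\<lambda>r. (D (n - 1) r s)\<^sup>2 + 1) \<longlongrightarrow> p\<^sup>2 + 1) (at_left s)"
        by (intro tendsto_intros p)
      show "p\<^sup>2 + 1 \<le> F * ((D (n - 1) r s)\<^sup>2 + 1)"
        by (rule tendsto_upperbound[OF * _ trivial_limit_at_left_real]) (rule eventually_mono[OF ev(1)], use one_side[OF s] r in auto)
      show "(D (n - 1) r s)\<^sup>2 + 1 \<le> F * (p\<^sup>2 + 1)"
        by (rule tendsto_lowerbound[OF tendsto_mult_left[OF *] _ trivial_limit_at_left_real])
          (rule eventually_mono[OF ev(1)], use one_side[OF s] r in auto)
    qed
    have right: "(p + 1)\<^sup>2 + 1 \<le> F * ((D (n - 1) r s)\<^sup>2 + 1)"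
      "(D (n - 1) r s)\<^sup>2 + 1 \<le> F * ((p + 1)\<^sup>2 + 1)"
      if r: "r \<in> I" "s < r" for r
    proof -
      have *: "((\<lambda>r. (D (n - 1) r s)\<^sup>2 + 1) \<longlongrightarrow> (p + 1)\<^sup>2 + 1) (at_right s)"
        by (intro tendsto_intros p)
      show "(p + 1)\<^sup>2 + 1 \<le> F * ((D (n - 1) r s)\<^sup>2 + 1)"
        by (rule tendsto_upperbound[OF * _ trivial_limit_at_right_real]) (rule eventually_mono[OF ev(2)], use one_side[OF s] r in auto)
      show "(D (n - 1) r s)\<^sup>2 + 1 \<le> F * ((p + 1)\<^sup>2 + 1)"
        by (rule tendsto_lowerbound[OF tendsto_mult_left[OF *] _ trivial_limit_at_right_real])
          (rule eventually_mono[OF ev(2)], use one_side[OF s] r in auto)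
    qed
    have jump: "(p + 1)\<^sup>2 + 1 \<le> 3 * (p\<^sup>2 + 1)" "p\<^sup>2 + 1 \<le> 3 * ((p + 1)\<^sup>2 + 1)"
    proof -
      have "0 \<le> (p - 1)\<^sup>2 + p\<^sup>2" "0 \<le> (p + 1)\<^sup>2 + (p + 2)\<^sup>2"
        by simp_all
      then show "(p + 1)\<^sup>2 + 1 \<le> 3 * (p\<^sup>2 + 1)" "p\<^sup>2 + 1 \<le> 3 * ((p + 1)\<^sup>2 + 1)"
        by (simp_all add: power2_eq_square algebra_simps)
    qed
    have chain: "x \<le> 3 * F\<^sup>2 * w" if "x \<le> F * y" "y \<le> 3 * z" "z \<le> F * w" for x y z w
    proof -
      have "x \<le> F * (3 * (F * w))"
        using that F by (smt (verit) mult_left_mono)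
      then show ?thesis
        by (simp add: power2_eq_square algebra_simps)
    qed
    show ?thesis
    proof (cases "t < s \<longleftrightarrow> t0 < s")
      case True
      have "(D (n - 1) t s)\<^sup>2 + 1 \<le> F * ((D (n - 1) t0 s)\<^sup>2 + 1)"
        using True s t by (intro one_side) auto
      also have "\<dots> \<le> 3 * F\<^sup>2 * ((D (n - 1) t0 s)\<^sup>2 + 1)"
        using F by (intro mult_right_mono) (auto simp: power2_eq_square)
      finally show ?thesis .
    next
      case False
      then show ?thesis
        using chain[OF left(2)[of t] jump(2) right(1)[of t0]]
          chain[OF right(2)[of t] jump(1) left(1)[of t0]] t by (cases "t < s") auto
    qed
  qed
  moreover have "0 < 3 * F\<^sup>2"
    using F by simp
  ultimately show ?thesis
    by blast
qed

lemma D_bounded: "\<exists>B\<ge>0. \<forall>j\<le>n. \<forall>s\<in>{x0<..<x1}. \<forall>t\<in>I - {s}. \<bar>D j t s\<bar> \<le> B"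
proof -
  obtain B0 where B0: "\<And>j t s. j + 2 \<le> n \<Longrightarrow> t \<in> I \<Longrightarrow> s \<in> I \<Longrightarrow> \<bar>D j t s\<bar> \<le> B0"
    using D_bounded_low by blast
  obtain K where K: "0 \<le> K"
    "\<And>t w b. t \<in> I \<Longrightarrow> (\<And>j. j < n \<Longrightarrow> \<bar>w j\<bar> \<le> b) \<Longrightarrow> \<bar>jet_rhs n k a M t w\<bar> \<le> K * b"
    using jet_rhs_bounded by blast
  obtain E where E: "0 < E" "\<And>s t t0. s \<in> {x0<..<x1} \<Longrightarrow> t \<in> I - {s} \<Longrightarrow> t0 \<in> I - {s} \<Longrightarrow>
      (D (n - 1) t s)\<^sup>2 + 1 \<le> E * ((D (n - 1) t0 s)\<^sup>2 + 1)"
    using top_D_comparison by blast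
  \<comment> \<open>A point \<open>s\<close> in one half of the interval stays away from the endpoint of the other half, where
    compactness bounds the derivative.\<close>
  define m where "m = (x0 + x1) / 2"
  have "bounded ((\<lambda>s. D (n - 1) x0 s) ` {m..x1})"
    using ivl by (intro compact_imp_bounded compact_continuous_image D_cont_snd_off) (auto simp: m_def)
  then obtain b0 where b0: "\<And>s. s \<in> {m..x1} \<Longrightarrow> \<bar>D (n - 1) x0 s\<bar> \<le> b0"
    unfolding bounded_iff by fastforce
  have "bounded ((\<lambda>s. D (n - 1) x1 s) ` {x0..m})"
    using ivl by (intro compact_imp_bounded compact_continuous_image D_cont_snd_off) (auto simp: m_def)
  then obtain b1 where b1: "\<And>s. s \<in> {x0..m} \<Longrightarrow> \<bar>D (n - 1) x1 s\<bar> \<le> b1"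
    unfolding bounded_iff by fastforce
  define B1 where "B1 = E * (b0\<^sup>2 + b1\<^sup>2 + 1)"
  have top: "\<bar>D (n - 1) t s\<bar> \<le> B1" if s: "s \<in> {x0<..<x1}" and t: "t \<in> I - {s}" for s t
  proof -
    obtain t0 where t0: "t0 \<in> I - {s}" "(D (n - 1) t0 s)\<^sup>2 \<le> b0\<^sup>2 + b1\<^sup>2"
    proof (cases "m \<le> s")
      case True
      then have "\<bar>D (n - 1) x0 s\<bar>\<^sup>2 \<le> b0\<^sup>2"
        using b0[of s] s by (intro power_mono) auto
      then have "(D (n - 1) x0 s)\<^sup>2 \<le> b0\<^sup>2 + b1\<^sup>2"
        using zero_le_power2[of b1] unfolding power2_abs by linarith
      then show ?thesis
        by (rule that[of x0, rotated]) (use s in auto)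
    next
      case False
      then have "\<bar>D (n - 1) x1 s\<bar>\<^sup>2 \<le> b1\<^sup>2"
        using b1[of s] s by (intro power_mono) auto
      then have "(D (n - 1) x1 s)\<^sup>2 \<le> b0\<^sup>2 + b1\<^sup>2"
        using zero_le_power2[of b0] unfolding power2_abs by linarith
      then show ?thesis
        by (rule that[of x1, rotated]) (use s in auto)
    qed
    have "0 \<le> (\<bar>D (n - 1) t s\<bar> - 1)\<^sup>2"
      by simp
    then have "2 * \<bar>D (n - 1) t s\<bar> \<le> (D (n - 1) t s)\<^sup>2 + 1"
      by (simp add: power2_diff)
    also have "\<dots> \<le> E * ((D (n - 1) t0 s)\<^sup>2 + 1)"
      using E s t t0 by blast
    also have "\<dots> \<le> B1"
      unfolding B1_def using E t0 by (intro mult_left_mono) auto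
    finally show ?thesis
      by linarith
  qed
  define B2 where "B2 = max \<bar>B0\<bar> \<bar>B1\<bar>"
  have lower: "\<bar>D j t s\<bar> \<le> B2" if "j < n" "s \<in> {x0<..<x1}" "t \<in> I - {s}" for j s t
  proof (cases "j = n - 1")
    case True
    then show ?thesis
      using top[of s t] that by (simp add: B2_def)
  next
    case False
    then have "j + 2 \<le> n"
      using that by simp
    then show ?thesis
      using B0[of j t s] that by (auto simp: B2_def)
  qed
  have "\<bar>D j t s\<bar> \<le> max B2 (K * B2)" if "j \<le> n" "s \<in> {x0<..<x1}" "t \<in> I - {s}" for j s t
  proof (cases "j = n")
    case True
    have "\<bar>jet_rhs n k a M t (\<lambda>j. D j t s)\<bar> \<le> K * B2"
      using that lower by (intro K) auto
    then show ?thesis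
      using D_ode[of s t] that True by simp
  next
    case False
    then show ?thesis
      using lower[of j s t] that by simp
  qed
  moreover have "0 \<le> max B2 (K * B2)"
    by (simp add: B2_def)
  ultimately show ?thesis
    by blast
qed

subsection \<open>Removing the jump\<close>

text \<open>
  Subtracting a unit step at \<open>s\<close> from the derivative of order \<open>n - 1\<close>, and filling in the limit at
  \<open>s\<close>, turns every column \<open>D j (\<cdot>, s)\<close> with \<open>j < n\<close> into a continuous function to which the
  fundamental theorem of calculus applies.
\<close>

definition R :: "nat \<Rightarrow> real \<Rightarrow> real \<Rightarrow> real" where
  "R j t s =
     (if j \<noteq> n - 1 then D j t s
      else if t = s then Lim (at_left s) (\<lambda>r. D j r s)
      else D j t s - of_bool (s < t))"

lemma R_off_diag: "t \<noteq> s \<Longrightarrow> R j t s = D j t s - of_bool (j = n - 1 \<and> s < t)"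
  by (simp add: R_def)

lemma R_low: "j \<noteq> n - 1 \<Longrightarrow> R j t s = D j t s"
  by (simp add: R_def)

lemma R_deriv:
  assumes "j < n" "t \<in> I" "s \<in> I" "t \<noteq> s"
  shows "((\<lambda>r. R j r s) has_vector_derivative D (Suc j) t s) (at t within I)"
proof (rule has_vector_derivative_transform_within)
  show "((\<lambda>r. D j r s - of_bool (j = n - 1 \<and> s < t)) has_vector_derivative D (Suc j) t s) (at t within I)"
    using has_vector_derivative_diff[OF D_deriv[OF assms] has_vector_derivative_const] by simp
  show "0 < \<bar>t - s\<bar>"
    using assms by simp
  show "D j r s - of_bool (j = n - 1 \<and> s < t) = R j r s" if "r \<in> I" "dist r t < \<bar>t - s\<bar>" for r
  proof -
    have "r \<noteq> s" "s < r \<longleftrightarrow> s < t"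
      using that by (auto simp: dist_real_def abs_if split: if_splits)
    then show ?thesis
      by (simp add: R_off_diag)
  qed
qed (use assms in auto)

lemma R_cont:
  assumes "j < n" "s \<in> {x0<..<x1}"
  shows "continuous_on I (\<lambda>t. R j t s)"
proof (cases "j = n - 1")
  case False
  then show ?thesis
    using assms D_cont_fst[of j s] by (simp add: R_low)
next
  case True
  obtain p where p: "((\<lambda>r. D (n - 1) r s) \<longlongrightarrow> p) (at_left s)"
    "((\<lambda>r. D (n - 1) r s) \<longlongrightarrow> p + 1) (at_right s)"
    using D_jump[OF assms(2)] .
  have "((\<lambda>r. R j r s) \<longlongrightarrow> p) (at_left s)"
    using p(1) by (rule Lim_transform_eventually)
      (auto simp: R_off_diag True eventually_at_filter)
  moreover have "((\<lambda>r. R j r s) \<longlongrightarrow> p) (at_right s)"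
  proof (rule Lim_transform_eventually)
    show "((\<lambda>r. D (n - 1) r s - 1) \<longlongrightarrow> p) (at_right s)"
      using tendsto_diff[OF p(2) tendsto_const[of 1]] by simp
  qed (auto simp: R_off_diag True eventually_at_filter)
  moreover have "R j s s = p"
    using tendsto_Lim[OF trivial_limit_at_left_real p(1)] by (simp add: R_def True)
  ultimately have at_s: "isCont (\<lambda>r. R j r s) s"
    by (simp add: isCont_def filterlim_at_split)
  have "continuous (at t within I) (\<lambda>r. R j r s)" if "t \<in> I" for t
  proof (cases "t = s")
    case True
    then show ?thesis
      using at_s continuous_at_imp_continuous_at_within by blast
  next
    case False
    then show ?thesis
      using assms that by (intro has_vector_derivative_continuous[OF R_deriv]) auto
  qed
  then show ?thesis
    by (simp add: continuous_on_eq_continuous_within)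
qed

lemma R_has_integral:
  assumes "j < n" "s \<in> {x0<..<x1}" "t1 \<in> I" "t2 \<in> I" "t1 \<le> t2"
  shows "((\<lambda>t. D (Suc j) t s) has_integral (R j t2 s - R j t1 s)) {t1..t2}"
proof (rule fundamental_theorem_of_calculus_interior_strong[where S = "{s}"])
  show "((\<lambda>t. R j t s) has_vector_derivative D (Suc j) t s) (at t)"
    if "t \<in> {t1<..<t2} - {s}" for t
    using R_deriv[of j t s] that assms at_within_Icc_at[of x0 t x1] by auto
  show "continuous_on {t1..t2} (\<lambda>t. R j t s)"
    using R_cont[OF assms(1,2)] by (rule continuous_on_subset) (use assms in auto)
qed (use assms in auto)

section \<open>Integral operators with the Green's function as kernel\<close>

text \<open>
  The kernel is set to zero on the diagonal, where the derivatives of order \<open>n - 1\<close> and \<open>n\<close> have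
  arbitrary values, and for \<open>r\<close> outside the open interval, where the equation and the boundary
  conditions are not imposed on \<open>g (\<cdot>, r)\<close>. Within \<open>I \<times> I\<close> only null sets are affected,
  and the equation and the boundary conditions then hold for all \<open>r\<close>.
\<close>

definition K :: "nat \<Rightarrow> real \<Rightarrow> real \<Rightarrow> real" where
  "K j t r = (if t \<in> I \<and> r \<in> {x0<..<x1} \<and> t \<noteq> r then D j t r else 0)"

definition U :: "(real \<Rightarrow> real) \<Rightarrow> nat \<Rightarrow> real \<Rightarrow> real" where
  "U \<sigma> j t = (\<integral>r. K j t r * \<sigma> r \<partial>lborel)"

lemma K_measurable:
  assumes "j \<le> n"
  shows "(\<lambda>z. K j (fst z) (snd z)) \<in> borel_measurable borel"
proof -
  define A where "A = I \<times> {x0<..<x1} - {z::real \<times> real. fst z = snd z}"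
  have "closed {z::real \<times> real. fst z = snd z}"
    by (intro closed_Collect_eq continuous_intros)
  moreover have "I \<times> {x0<..<x1} \<in> sets borel"
    by (intro borel_Times) auto
  ultimately have "A \<in> sets borel"
    unfolding A_def by (intro sets.Diff) auto
  moreover have "continuous_on A (\<lambda>(t, s). D j t s)"
    by (rule continuous_on_subset[OF D_cont_pair_off[OF assms]]) (auto simp: A_def)
  ultimately have "(\<lambda>z. indicator A z *\<^sub>R (\<lambda>(t, s). D j t s) z) \<in> borel_measurable borel"
    by (rule borel_measurable_continuous_on_indicator)
  moreover have "(\<lambda>z. indicator A z *\<^sub>R (\<lambda>(t, s). D j t s) z) = (\<lambda>z. K j (fst z) (snd z))"
    by (auto simp: fun_eq_iff K_def A_def indicator_def)
  ultimately show ?thesis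
    by simp
qed

lemma K_measurable_fst:
  assumes "j \<le> n"
  shows "(\<lambda>t. K j t r) \<in> borel_measurable borel"
proof -
  have "(\<lambda>t. (t, r)) \<in> borel \<rightarrow>\<^sub>M borel"
    by (intro borel_measurable_continuous_onI continuous_intros)
  from measurable_compose[OF this K_measurable[OF assms]] show ?thesis
    by simp
qed

lemma K_measurable_snd:
  assumes "j \<le> n"
  shows "(\<lambda>r. K j t r) \<in> borel_measurable borel"
proof -
  have "(\<lambda>r. (t, r)) \<in> borel \<rightarrow>\<^sub>M borel"
    by (intro borel_measurable_continuous_onI continuous_intros)
  from measurable_compose[OF this K_measurable[OF assms]] show ?thesis
    by simp
qed

lemma K_bounded: "\<exists>B\<ge>0. \<forall>j\<le>n. \<forall>t r. \<bar>K j t r\<bar> \<le> B"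
proof -
  obtain B where "0 \<le> B" "\<And>j s t. j \<le> n \<Longrightarrow> s \<in> {x0<..<x1} \<Longrightarrow> t \<in> I - {s} \<Longrightarrow> \<bar>D j t s\<bar> \<le> B"
    using D_bounded by blast
  then show ?thesis
    by (intro exI[of _ B]) (auto simp: K_def)
qed

lemma K_ode:
  assumes "t \<in> I"
  shows "K n t r = jet_rhs n k a M t (\<lambda>j. K j t r)"
proof (cases "r \<in> {x0<..<x1} \<and> t \<noteq> r")
  case True
  then show ?thesis
    using D_ode[of r t] assms by (simp add: K_def)
next
  case False
  then have "K j t r = 0" for j
    by (auto simp: K_def)
  then show ?thesis
    by (simp add: jet_rhs_def)
qed

lemma K_bdry:
  assumes "i \<in> {1..n}"
  shows "(\<Sum>j<n. \<alpha> i j * K j x0 r + \<beta> i j * K j x1 r) = 0"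
proof (cases "r \<in> {x0<..<x1}")
  case True
  then show ?thesis
    using D_bdry[OF True assms] ivl by (auto simp: K_def)
next
  case False
  then have "K j t r = 0" for j t
    by (auto simp: K_def)
  then show ?thesis
    by simp
qed

context
  fixes \<sigma> :: "real \<Rightarrow> real" and C :: real
  assumes \<sigma>_meas: "\<sigma> \<in> borel_measurable borel" and \<sigma>_bound: "\<And>r. \<bar>\<sigma> r\<bar> \<le> C"
begin

lemma K_mult_bounded: "\<exists>Q\<ge>0. \<forall>j\<le>n. \<forall>t r. \<bar>K j t r * \<sigma> r\<bar> \<le> Q"
proof -
  obtain B where B: "0 \<le> B" "\<And>j t r. j \<le> n \<Longrightarrow> \<bar>K j t r\<bar> \<le> B"
    using K_bounded by blast
  have "0 \<le> C"
    using \<sigma>_bound[of 0] by linarith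
  then show ?thesis
    using B \<sigma>_bound by (intro exI[of _ "B * C"]) (auto simp: abs_mult intro!: mult_mono)
qed

lemma K_mult_integrable:
  assumes "j \<le> n"
  shows "integrable lborel (\<lambda>r. K j t r * \<sigma> r)"
proof -
  obtain Q where Q: "0 \<le> Q" "\<And>t r. \<bar>K j t r * \<sigma> r\<bar> \<le> Q"
    using K_mult_bounded assms by blast
  show ?thesis
  proof (rule integrableI_bounded_set[where A = I and B = Q])
    show "(\<lambda>r. K j t r * \<sigma> r) \<in> borel_measurable lborel"
      using borel_measurable_times[OF K_measurable_snd[OF assms] \<sigma>_meas] by simp
    show "AE r in lborel. r \<in> I \<longrightarrow> norm (K j t r * \<sigma> r) \<le> Q"
      using Q by simp
    show "AE r in lborel. r \<notin> I \<longrightarrow> K j t r * \<sigma> r = 0"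
      by (auto simp: K_def)
  qed (auto simp: emeasure_lborel_Icc_eq)
qed

text \<open>
  At every \<open>r\<close> other than \<open>t\<close> the kernel is continuous in its first argument at \<open>t\<close>, so dominated
  convergence applies even to the discontinuous kernels of order \<open>n - 1\<close> and \<open>n\<close>.
\<close>

lemma U_cont:
  assumes "j \<le> n"
  shows "continuous_on I (U \<sigma> j)"
proof (rule continuous_on_sequentiallyI)
  fix u :: "nat \<Rightarrow> real" and t assume u: "\<forall>m. u m \<in> I" "t \<in> I" "u \<longlonglongrightarrow> t"
  obtain Q where Q: "0 \<le> Q" "\<And>t r. \<bar>K j t r * \<sigma> r\<bar> \<le> Q"
    using K_mult_bounded assms by blast
  show "(\<lambda>m. U \<sigma> j (u m)) \<longlonglongrightarrow> U \<sigma> j t"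
    unfolding U_def
  proof (rule integral_dominated_convergence[where w = "\<lambda>r. indicator I r * Q"])
    show "(\<lambda>r. K j t r * \<sigma> r) \<in> borel_measurable lborel"
      "(\<lambda>r. K j (u m) r * \<sigma> r) \<in> borel_measurable lborel" for m
      using K_mult_integrable[OF assms] by (auto dest: borel_measurable_integrable)
    show "integrable lborel (\<lambda>r. indicator I r * Q)"
      by (intro integrable_mult_left integrable_real_indicator) (auto simp: emeasure_lborel_Icc_eq)
    show "AE r in lborel. norm (K j (u m) r * \<sigma> r) \<le> indicator I r * Q" for m
    proof (intro AE_I2)
      fix r
      show "norm (K j (u m) r * \<sigma> r) \<le> indicator I r * Q"
        using Q(2)[of "u m" r] by (cases "r \<in> I") (auto simp: K_def)
    qed
    show "AE r in lborel. (\<lambda>m. K j (u m) r * \<sigma> r) \<longlonglongrightarrow> K j t r * \<sigma> r"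
      using AE_lborel_singleton[of t]
    proof eventually_elim
      case (elim r)
      have "(\<lambda>m. K j (u m) r) \<longlonglongrightarrow> K j t r"
      proof (cases "r \<in> {x0<..<x1}")
        case True
        have "continuous_on (I - {r}) (\<lambda>t. D j t r)"
          using True assms by (intro D_cont_fst_off) auto
        moreover have ev: "eventually (\<lambda>m. u m \<noteq> r) sequentially"
          using tendsto_imp_eventually_ne[OF u(3)] elim by auto
        then have "eventually (\<lambda>m. u m \<in> I - {r}) sequentially"
          using u by (auto elim: eventually_mono)
        ultimately have "(\<lambda>m. D j (u m) r) \<longlonglongrightarrow> D j t r"
          using u elim by (intro continuous_on_tendsto_compose[where f = "\<lambda>t. D j t r" and g = u]) auto
        moreover have "eventually (\<lambda>m. D j (u m) r = K j (u m) r) sequentially"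
          by (rule eventually_mono[OF ev]) (use u True in \<open>auto simp: K_def\<close>)
        ultimately have "(\<lambda>m. K j (u m) r) \<longlonglongrightarrow> D j t r"
          by (rule Lim_transform_eventually)
        then show ?thesis
          using u True elim by (auto simp: K_def)
      next
        case False
        then have "K j t r = 0" for t
          by (auto simp: K_def)
        then show ?thesis
          by simp
      qed
      then show ?case
        by (intro tendsto_intros)
    qed
  qed
qed

text \<open>
  By Fubini the relation between consecutive columns of the kernel passes to the operators. The
  unit step that separates column \<open>n - 1\<close> from a primitive of column \<open>n\<close> integrates to
  \<open>\<integral>r\<in>{t1..t2}. \<sigma> r\<close>; this is how \<open>\<sigma>\<close> becomes the right-hand side of the equation.
\<close>

lemma U_has_integral:
  assumes "j < n" "t1 \<in> I" "t2 \<in> I" "t1 \<le> t2"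
  shows "((\<lambda>t. U \<sigma> (Suc j) t + of_bool (j = n - 1) * \<sigma> t) has_integral (U \<sigma> j t2 - U \<sigma> j t1)) {t1..t2}"
proof -
  define c :: real where "c = of_bool (j = n - 1)"
  define f where "f t r = indicator {t1..t2} t * (K (Suc j) t r * \<sigma> r)" for t r
  have j: "Suc j \<le> n"
    using assms(1) by simp
  obtain B where B: "0 \<le> B" "\<And>t r. \<bar>K (Suc j) t r\<bar> \<le> B"
    using K_bounded j by blast
  obtain Q where Q: "0 \<le> Q" "\<And>t r. \<bar>K (Suc j) t r * \<sigma> r\<bar> \<le> Q"
    using K_mult_bounded j by blast
  have f_int: "integrable (lborel \<Otimes>\<^sub>M lborel) (\<lambda>(t, r). f t r)"
  proof (subst lborel_prod, rule integrableI_bounded_set[where A = "I \<times> I" and B = Q])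
    have "(\<lambda>z. indicator {t1..t2} (fst z) * (K (Suc j) (fst z) (snd z) * \<sigma> (snd z)))
        \<in> borel_measurable (borel :: (real \<times> real) measure)"
    proof (intro borel_measurable_times)
      show "(\<lambda>z. K (Suc j) (fst z) (snd z)) \<in> borel_measurable borel"
        using assms(1) by (intro K_measurable) simp
      show "(\<lambda>z::real \<times> real. \<sigma> (snd z)) \<in> borel_measurable borel"
        by (rule measurable_compose[OF _ \<sigma>_meas])
          (intro borel_measurable_continuous_onI continuous_intros)
      show "(\<lambda>z::real \<times> real. indicator {t1..t2} (fst z) :: real) \<in> borel_measurable borel"
        by (rule measurable_compose[OF borel_measurable_continuous_onI borel_measurable_indicator])
          (auto intro: continuous_intros)
    qed
    then show "(\<lambda>(t, r). f t r) \<in> borel_measurable lborel"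
      by (simp add: f_def case_prod_beta')
    show "AE z in lborel. z \<in> I \<times> I \<longrightarrow> norm (case z of (t, r) \<Rightarrow> f t r) \<le> Q"
      using Q by (auto simp: f_def indicator_def intro!: AE_I2)
    show "AE z in lborel. z \<notin> I \<times> I \<longrightarrow> (case z of (t, r) \<Rightarrow> f t r) = 0"
      by (intro AE_I2) (auto simp: f_def K_def split: if_splits)
    have "emeasure lborel (I \<times> I) = emeasure lborel I * emeasure lborel I"
      by (rule lborel.emeasure_pair_measure_Times[where N = lborel, unfolded lborel_prod]) auto
    then show "emeasure lborel (I \<times> I) < \<infinity>"
      by (simp add: emeasure_lborel_Icc_eq ennreal_mult_less_top)
  qed (simp add: borel_Times)
  have t_first: "(\<integral>r. f t r \<partial>lborel) = indicator {t1..t2} t * U \<sigma> (Suc j) t" for t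
    by (simp add: f_def U_def)
  \<comment> \<open>The column of the kernel at \<open>r\<close> is a primitive of the next one, except for the unit jump that
    a column of order \<open>n - 1\<close> has at \<open>t = r\<close>.\<close>
  have r_first: "(\<integral>t. f t r \<partial>lborel) =
      K j t2 r * \<sigma> r - K j t1 r * \<sigma> r - c * (indicator {t1..t2} r * \<sigma> r)"
    if r: "r \<noteq> t1" "r \<noteq> t2" for r
  proof (cases "r \<in> {x0<..<x1}")
    case True
    have "integrable lborel (\<lambda>t. indicator {t1..t2} t *\<^sub>R K (Suc j) t r)"
    proof (rule integrableI_bounded_set[where A = I and B = B])
      have "(\<lambda>t. K (Suc j) t r) \<in> borel_measurable lborel"
        using K_measurable_fst[of "Suc j" r] assms(1) by simp
      then show "(\<lambda>t. indicator {t1..t2} t *\<^sub>R K (Suc j) t r) \<in> borel_measurable lborel"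
        by measurable
      show "AE t in lborel. t \<in> I \<longrightarrow> norm (indicator {t1..t2} t *\<^sub>R K (Suc j) t r) \<le> B"
        using B by (auto simp: indicator_def)
      show "AE t in lborel. t \<notin> I \<longrightarrow> indicator {t1..t2} t *\<^sub>R K (Suc j) t r = 0"
        by (intro AE_I2) (auto simp: K_def)
    qed (auto simp: emeasure_lborel_Icc_eq)
    then have "set_integrable lborel {t1..t2} (\<lambda>t. K (Suc j) t r)"
      by (simp add: set_integrable_def)
    from set_borel_integral_eq_integral(2)[OF this]
    have "(\<integral>t. indicator {t1..t2} t * K (Suc j) t r \<partial>lborel) = integral {t1..t2} (\<lambda>t. K (Suc j) t r)"
      by (simp add: set_lebesgue_integral_def)
    also have "((\<lambda>t. K (Suc j) t r) has_integral R j t2 r - R j t1 r) {t1..t2}"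
      by (rule has_integral_spike_finite[OF _ _ R_has_integral[OF assms(1) True assms(2-4)],
            where S = "{r}"]) (use assms True in \<open>auto simp: K_def\<close>)
    then have "integral {t1..t2} (\<lambda>t. K (Suc j) t r) = R j t2 r - R j t1 r"
      by (rule integral_unique)
    also have "\<dots> = K j t2 r - K j t1 r - c * indicator {t1..t2} r"
      using r assms True by (auto simp: R_off_diag K_def c_def indicator_def)
    finally have "(\<integral>t. indicator {t1..t2} t * K (Suc j) t r \<partial>lborel) * \<sigma> r =
        (K j t2 r - K j t1 r - c * indicator {t1..t2} r) * \<sigma> r"
      by simp
    then show ?thesis
      by (simp add: f_def mult.assoc[symmetric] left_diff_distrib)
  next
    case False
    then have "r \<notin> {t1..t2}"
      using r assms by auto
    then show ?thesis
      using False by (auto simp: f_def K_def)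
  qed
  have \<sigma>_int: "integrable lborel (\<lambda>t. indicator {t1..t2} t * \<sigma> t)"
  proof (rule integrableI_bounded_set[where A = "{t1..t2}" and B = C])
    show "(\<lambda>t. indicator {t1..t2} t * \<sigma> t) \<in> borel_measurable lborel"
      using \<sigma>_meas by measurable
  qed (use \<sigma>_bound in \<open>auto simp: indicator_def emeasure_lborel_Icc_eq\<close>)
  have U_int: "integrable lborel (\<lambda>t. indicator {t1..t2} t * U \<sigma> (Suc j) t)"
    using lborel_pair.integrable_fst[OF f_int] by (simp add: t_first)
  have "(\<integral>t. indicator {t1..t2} t * U \<sigma> (Suc j) t \<partial>lborel) = (\<integral>t. (\<integral>r. f t r \<partial>lborel) \<partial>lborel)"
    by (simp add: t_first)
  also have "\<dots> = (\<integral>r. (\<integral>t. f t r \<partial>lborel) \<partial>lborel)"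
    using lborel_pair.Fubini_integral[of f] f_int by simp
  also have "\<dots> = (\<integral>r. K j t2 r * \<sigma> r - K j t1 r * \<sigma> r - c * (indicator {t1..t2} r * \<sigma> r) \<partial>lborel)"
  proof (rule integral_cong_AE)
    show "(\<lambda>r. \<integral>t. f t r \<partial>lborel) \<in> borel_measurable lborel"
      using lborel_pair.integrable_snd[OF f_int] by (rule borel_measurable_integrable)
    show "(\<lambda>r. K j t2 r * \<sigma> r - K j t1 r * \<sigma> r - c * (indicator {t1..t2} r * \<sigma> r))
        \<in> borel_measurable lborel"
      using K_mult_integrable[of j] \<sigma>_int assms(1) by (intro borel_measurable_integrable) auto
    show "AE r in lborel. (\<integral>t. f t r \<partial>lborel) =
        K j t2 r * \<sigma> r - K j t1 r * \<sigma> r - c * (indicator {t1..t2} r * \<sigma> r)"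
      using AE_lborel_singleton[of t1] AE_lborel_singleton[of t2]
      by eventually_elim (rule r_first)
  qed
  also have "\<dots> = U \<sigma> j t2 - U \<sigma> j t1 - c * (\<integral>r. indicator {t1..t2} r * \<sigma> r \<partial>lborel)"
    using K_mult_integrable[of j] \<sigma>_int assms(1) by (simp add: U_def)
  finally have "(\<integral>t. indicator {t1..t2} t * U \<sigma> (Suc j) t + c * (indicator {t1..t2} t * \<sigma> t) \<partial>lborel)
      = U \<sigma> j t2 - U \<sigma> j t1"
    using U_int \<sigma>_int by simp
  moreover have "integrable lborel (\<lambda>t. indicator {t1..t2} t * U \<sigma> (Suc j) t + c * (indicator {t1..t2} t * \<sigma> t))"
    using U_int \<sigma>_int by simp
  ultimately have "((\<lambda>t. indicator {t1..t2} t * U \<sigma> (Suc j) t + c * (indicator {t1..t2} t * \<sigma> t))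
      has_integral U \<sigma> j t2 - U \<sigma> j t1) UNIV"
    using has_integral_integral_lborel by metis
  moreover have "(\<lambda>t. indicator {t1..t2} t * U \<sigma> (Suc j) t + c * (indicator {t1..t2} t * \<sigma> t)) =
      (\<lambda>t. if t \<in> {t1..t2} then U \<sigma> (Suc j) t + c * \<sigma> t else 0)"
    by (auto simp: indicator_def)
  ultimately have "((\<lambda>t. if t \<in> {t1..t2} then U \<sigma> (Suc j) t + c * \<sigma> t else 0)
      has_integral U \<sigma> j t2 - U \<sigma> j t1) UNIV"
    by simp
  then show ?thesis
    unfolding c_def by (simp only: has_integral_restrict_UNIV)
qed

lemma U_ode:
  assumes "t \<in> I"
  shows "U \<sigma> n t = jet_rhs n k a M t (\<lambda>j. U \<sigma> j t)"
proof -
  have int: "integrable lborel (\<lambda>r. K j t r * \<sigma> r)" if "j \<le> n" for j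
    using K_mult_integrable that .
  have "U \<sigma> n t = (\<integral>r. - (\<Sum>j=1..n. a j t * (K (n - j) t r * \<sigma> r)) - M * (K k t r * \<sigma> r) \<partial>lborel)"
    unfolding U_def K_ode[OF assms] jet_rhs_def
    by (simp add: left_diff_distrib sum_distrib_right mult.assoc)
  also have "\<dots> = - (\<Sum>j=1..n. a j t * U \<sigma> (n - j) t) - M * U \<sigma> k t"
    using int k_less by (simp add: U_def)
  finally show ?thesis
    by (simp add: jet_rhs_def)
qed

lemma U_bdry:
  assumes "i \<in> {1..n}"
  shows "(\<Sum>j<n. \<alpha> i j * U \<sigma> j x0 + \<beta> i j * U \<sigma> j x1) = 0"
proof -
  have int: "integrable lborel (\<lambda>r. K j t r * \<sigma> r)" if "j < n" for j t
    using K_mult_integrable[of j] that by simp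
  have "(\<Sum>j<n. \<alpha> i j * U \<sigma> j x0 + \<beta> i j * U \<sigma> j x1)
      = (\<integral>r. (\<Sum>j<n. \<alpha> i j * (K j x0 r * \<sigma> r) + \<beta> i j * (K j x1 r * \<sigma> r)) \<partial>lborel)"
    using int by (simp add: U_def)
  also have "\<dots> = (\<integral>r. (\<Sum>j<n. \<alpha> i j * K j x0 r + \<beta> i j * K j x1 r) * \<sigma> r \<partial>lborel)"
    by (simp add: sum_distrib_right distrib_right mult.assoc)
  finally show ?thesis
    using K_bdry[OF assms] by simp
qed

end

end

section \<open>Comparison of two Green's functions\<close>

lemma jet_rhs_combine:
  "jet_rhs n k a M t (\<lambda>j. x j - y j + c * z j)
    = jet_rhs n k a M t x - jet_rhs n k a M t y + c * jet_rhs n k a M t z"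
  by (simp add: jet_rhs_def algebra_simps sum.distrib sum_subtractf sum_distrib_left)

lemma jet_rhs_shift: "jet_rhs n k a M' t w = jet_rhs n k a M t w - (M' - M) * w k"
  by (simp add: jet_rhs_def algebra_simps)

lemma jet_rhs_cong: "k < n \<Longrightarrow> (\<And>j. j < n \<Longrightarrow> v j = w j) \<Longrightarrow> jet_rhs n k a M t v = jet_rhs n k a M t w"
  by (simp add: jet_rhs_def)

text \<open>
  The homogeneous equation as a first-order system. In this form a solution is recognised from
  its candidate derivatives, without computing \<open>nderiv\<close> first.
\<close>

definition is_jet ::
  "real \<Rightarrow> real \<Rightarrow> nat \<Rightarrow> nat \<Rightarrow> (nat \<Rightarrow> real \<Rightarrow> real) \<Rightarrow> real \<Rightarrow> (nat \<Rightarrow> real \<Rightarrow> real) \<Rightarrow> bool" where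
  "is_jet x0 x1 n k a M w \<longleftrightarrow>
     (\<forall>j<n. \<forall>t\<in>{x0..x1}. (w j has_vector_derivative
        (if Suc j < n then w (Suc j) t else jet_rhs n k a M t (\<lambda>i. w i t))) (at t within {x0..x1}))"

lemma nderiv_jet:
  assumes "x0 < x1" "is_jet x0 x1 n k a M w" "t \<in> {x0..x1}" "j < n"
  shows "nderiv {x0..x1} j (w 0) t = w j t"
    and "(nderiv {x0..x1} j (w 0) has_vector_derivative
      (if Suc j < n then w (Suc j) t else jet_rhs n k a M t (\<lambda>i. w i t))) (at t within {x0..x1})"
proof -
  have der: "(nderiv {x0..x1} j (w 0) has_vector_derivative
      (if Suc j < n then w (Suc j) t else jet_rhs n k a M t (\<lambda>i. w i t))) (at t within {x0..x1})"
    if "t \<in> {x0..x1}" "j < n" "\<forall>r\<in>{x0..x1}. nderiv {x0..x1} j (w 0) r = w j r" for t j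
    by (rule has_vector_derivative_transform[OF that(1)])
      (use that assms(2) in \<open>auto simp: is_jet_def\<close>)
  have eq: "\<forall>r\<in>{x0..x1}. nderiv {x0..x1} j (w 0) r = w j r" if "j < n" for j
    using that
  proof (induction j)
    case 0
    then show ?case
      by (simp add: nderiv_0)
  next
    case (Suc j)
    show ?case
    proof
      fix r assume "r \<in> {x0..x1}"
      with der[of r j] Suc have "(nderiv {x0..x1} j (w 0) has_vector_derivative w (Suc j) r) (at r within {x0..x1})"
        by simp
      then show "nderiv {x0..x1} (Suc j) (w 0) r = w (Suc j) r"
        using deriv_in_eq[OF assms(1)] \<open>r \<in> {x0..x1}\<close> by (simp add: nderiv_Suc)
    qed
  qed
  show "nderiv {x0..x1} j (w 0) t = w j t"
    using eq assms by blast
  show "(nderiv {x0..x1} j (w 0) has_vector_derivative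
      (if Suc j < n then w (Suc j) t else jet_rhs n k a M t (\<lambda>i. w i t))) (at t within {x0..x1})"
    by (rule der) (use eq assms in auto)
qed

lemma continuous_jet_rhs:
  assumes "\<And>j. j \<in> {1..n} \<Longrightarrow> continuous_on S (a j)" "k < n" "\<And>j. j < n \<Longrightarrow> continuous_on S (w j)"
  shows "continuous_on S (\<lambda>t. jet_rhs n k a M t (\<lambda>i. w i t))"
  unfolding jet_rhs_def using assms by (intro continuous_intros) auto

lemma bvp_solution_jet:
  assumes "x0 < x1" and jet: "is_jet x0 x1 n k a M w"
    and coef: "\<And>j. j \<in> {1..n} \<Longrightarrow> continuous_on {x0..x1} (a j)" and "k < n"
    and bdry: "\<And>i. i \<in> {1..n} \<Longrightarrow> (\<Sum>j<n. \<alpha> i j * w j x0 + \<beta> i j * w j x1) = 0"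
  shows "bvp_solution x0 x1 n k a \<alpha> \<beta> M (\<lambda>_. 0) (w 0)"
proof -
  note eq = nderiv_jet(1)[OF assms(1) jet] and der = nderiv_jet(2)[OF assms(1) jet]
  have top: "nderiv {x0..x1} n (w 0) t = jet_rhs n k a M t (\<lambda>i. w i t)" if "t \<in> {x0..x1}" for t
  proof -
    obtain m where m: "n = Suc m"
      using \<open>k < n\<close> by (cases n) auto
    then show ?thesis
      using deriv_in_eq[OF assms(1) that der[OF that, of m]] by (simp add: nderiv_Suc)
  qed
  have cont_low: "continuous_on {x0..x1} (nderiv {x0..x1} j (w 0))" if "j < n" for j
    using der that has_vector_derivative_continuous
    unfolding continuous_on_eq_continuous_within by blast
  have cont_w: "continuous_on {x0..x1} (w j)" if "j < n" for j
    by (rule continuous_on_eq[OF cont_low[OF that]]) (rule eq[OF _ that])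
  have "continuous_on {x0..x1} (nderiv {x0..x1} n (w 0))"
    by (rule continuous_on_eq[OF continuous_jet_rhs[OF coef \<open>k < n\<close> cont_w, where M = M]])
      (simp_all add: top)
  with cont_low have "C_class n {x0..x1} (w 0)"
    unfolding C_class_def by (auto intro: differentiableI_vector[OF der] simp: order_le_less)
  moreover have "T_op x0 x1 n k a M (w 0) t = 0" if "t \<in> {x0..x1}" for t
    unfolding T_op_eq_0_iff using eq that \<open>k < n\<close> by (simp add: top cong: jet_rhs_cong)
  moreover have "bdry x0 x1 n \<alpha> \<beta> i (w 0) = 0" if "i \<in> {1..n}" for i
    using bdry[OF that] eq \<open>x0 < x1\<close> by (simp add: bdry_def)
  ultimately show ?thesis
    by (simp add: bvp_solution_def)
qed

lemma jet_eq_0: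
  assumes "x0 < x1" "bvp_unique x0 x1 n k a \<alpha> \<beta> M" and jet: "is_jet x0 x1 n k a M w"
    and coef: "\<And>j. j \<in> {1..n} \<Longrightarrow> continuous_on {x0..x1} (a j)" and "k < n"
    and bdry: "\<And>i. i \<in> {1..n} \<Longrightarrow> (\<Sum>j<n. \<alpha> i j * w j x0 + \<beta> i j * w j x1) = 0"
    and "j < n" "t \<in> {x0..x1}"
  shows "w j t = 0"
proof -
  have "is_jet x0 x1 n k a M (\<lambda>_ _. 0)"
    by (auto simp: is_jet_def jet_rhs_def)
  then have "bvp_solution x0 x1 n k a \<alpha> \<beta> M (\<lambda>_. 0) (\<lambda>_. 0)"
    using bvp_solution_jet[of x0 x1 n k a M "\<lambda>_ _. 0"] assms by simp
  moreover have "bvp_solution x0 x1 n k a \<alpha> \<beta> M (\<lambda>_. 0) (w 0)"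
    using assms by (intro bvp_solution_jet) auto
  moreover obtain u where "\<And>v t. bvp_solution x0 x1 n k a \<alpha> \<beta> M (\<lambda>_. 0) v \<Longrightarrow> t \<in> {x0..x1} \<Longrightarrow> v t = u t"
    using assms(2) continuous_on_const unfolding bvp_unique_def by metis
  ultimately have zero: "w 0 t = 0" if "t \<in> {x0..x1}" for t
    using that by metis
  have "\<forall>t\<in>{x0..x1}. w j t = 0"
    using \<open>j < n\<close>
  proof (induction j)
    case 0
    then show ?case
      using zero by blast
  next
    case (Suc j)
    show ?case
    proof
      fix t assume t: "t \<in> {x0..x1}"
      have "(w j has_vector_derivative w (Suc j) t) (at t within {x0..x1})"
        using jet[unfolded is_jet_def, rule_format, OF Suc_lessD[OF Suc.prems] t] Suc.prems by simp
      then have "((\<lambda>_. 0) has_vector_derivative w (Suc j) t) (at t within {x0..x1})"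
        by (rule has_vector_derivative_transform[OF t, rotated]) (use Suc in auto)
      then show "w (Suc j) t = 0"
        using deriv_in_eq[OF assms(1) t] deriv_in_eq[OF assms(1) t has_vector_derivative_const]
        by metis
    qed
  qed
  then show ?thesis
    using assms by blast
qed

locale green_pair =
  G: green_function x0 x1 n k a \<alpha> \<beta> M g + G': green_function x0 x1 n k a \<alpha> \<beta> M' g'
  for x0 x1 n k a \<alpha> \<beta> M g M' g' +
  assumes unique: "bvp_unique x0 x1 n k a \<alpha> \<beta> M"
begin

text \<open>
  The integral in the formula for \<open>D\<^sup>l g' (t, s) - D\<^sup>l g (t, s)\<close>.
\<close>

abbreviation overlap :: "nat \<Rightarrow> real \<Rightarrow> real \<Rightarrow> real" where
  "overlap l t s \<equiv> G.U (\<lambda>r. G'.K k r s) l t"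

lemma K'_measurable: "(\<lambda>r. G'.K k r s) \<in> borel_measurable borel"
  using G'.K_measurable_fst G'.k_less by simp

lemma K'_bounded: "\<exists>C. \<forall>r s. \<bar>G'.K k r s\<bar> \<le> C"
  using G'.K_bounded less_imp_le[OF G'.k_less] by blast

text \<open>
  The functions \<open>w j\<close> of the proof are what should vanish: the difference of the two sides. The
  unit steps at \<open>s\<close> cancel in them, so they are continuous, and the right-hand side
  \<open>\<sigma> = D\<^sup>k g' (\<cdot>, s)\<close> cancels against the term by which the two equations differ. They thus form
  a solution of the homogeneous problem for \<open>M\<close>, even if \<open>\<sigma>\<close> itself jumps at \<open>s\<close>, which happens
  for \<open>k = n - 1\<close>.
\<close>

lemma representation:
  assumes s: "s \<in> {x0<..<x1}" and t: "t \<in> {x0..x1}" and l: "l < n" "l = n - 1 \<longrightarrow> t \<noteq> s"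
  shows "G'.D l t s - G.D l t s = (M - M') * overlap l t s"
proof -
  define \<sigma> where "\<sigma> r = G'.K k r s" for r
  obtain C where C: "\<And>r. \<bar>\<sigma> r\<bar> \<le> C"
    using K'_bounded unfolding \<sigma>_def by blast
  have \<sigma>_meas: "\<sigma> \<in> borel_measurable borel"
    using K'_measurable unfolding \<sigma>_def by simp
  note U_cont = G.U_cont[OF \<sigma>_meas C] and U_has_integral = G.U_has_integral[OF \<sigma>_meas C]
    and U_ode = G.U_ode[OF \<sigma>_meas C] and U_bdry = G.U_bdry[OF \<sigma>_meas C]
  define w where "w j r = G'.R j r s - G.R j r s + (M' - M) * G.U \<sigma> j r" for j r
  have w_off: "w j r = G'.D j r s - G.D j r s + (M' - M) * G.U \<sigma> j r" if "r \<noteq> s" for j r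
    using that by (simp add: w_def G.R_off_diag G'.R_off_diag)
  have w_cont: "continuous_on {x0..x1} (w j)" if "j < n" for j
    unfolding w_def using that s U_cont[of j]
    by (intro continuous_intros G.R_cont G'.R_cont) (auto simp: eta_contract_eq)
  define E where "E j r = (if Suc j < n then w (Suc j) r else jet_rhs n k a M r (\<lambda>i. w i r))" for j r
  have E_cont: "continuous_on {x0..x1} (E j)" for j
    using w_cont[of "Suc j"] continuous_jet_rhs[OF G.coef_cont G.k_less w_cont, where M = M]
    by (cases "Suc j < n") (auto simp: E_def)
  have E_off: "E j r = G'.D (Suc j) r s - G.D (Suc j) r s
      + (M' - M) * (G.U \<sigma> (Suc j) r + of_bool (j = n - 1) * \<sigma> r)"
    if "j < n" "r \<in> {x0..x1}" "r \<noteq> s" for j r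
  proof (cases "Suc j < n")
    case True
    then have "j \<noteq> n - 1"
      by simp
    then show ?thesis
      using that True by (simp add: E_def w_off)
  next
    case False
    then have j: "Suc j = n" "j = n - 1"
      using that by auto
    have "E j r = jet_rhs n k a M r (\<lambda>i. G'.D i r s - G.D i r s + (M' - M) * G.U \<sigma> i r)"
      using False that by (simp add: E_def w_off)
    also have "\<dots> = jet_rhs n k a M r (\<lambda>i. G'.D i r s) - G.D n r s + (M' - M) * G.U \<sigma> n r"
      using G.D_ode[OF s, of r] U_ode[of r] that by (simp add: jet_rhs_combine)
    also have "jet_rhs n k a M r (\<lambda>i. G'.D i r s) = G'.D n r s + (M' - M) * \<sigma> r"
      using G'.D_ode[OF s, of r] jet_rhs_shift[of n k a M' r "\<lambda>i. G'.D i r s" M] that s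
      by (simp add: \<sigma>_def G'.K_def)
    finally show ?thesis
      using j by (simp add: algebra_simps)
  qed
  have w_integral: "(E j has_integral w j r - w j x0) {x0..r}" if "j < n" "r \<in> {x0..x1}" for j r
  proof (rule has_integral_spike_finite[where S = "{s}"])
    have "x0 \<in> {x0..x1}" "x0 \<le> r"
      using that by auto
    then have "((\<lambda>r. G'.D (Suc j) r s - G.D (Suc j) r s
        + (M' - M) * (G.U \<sigma> (Suc j) r + of_bool (j = n - 1) * \<sigma> r)) has_integral
        (G'.R j r s - G'.R j x0 s) - (G.R j r s - G.R j x0 s) + (M' - M) * (G.U \<sigma> j r - G.U \<sigma> j x0)) {x0..r}"
      using that s
      by (intro has_integral_add has_integral_diff has_integral_mult_right
          G.R_has_integral G'.R_has_integral U_has_integral) auto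
    then show "((\<lambda>r. G'.D (Suc j) r s - G.D (Suc j) r s
        + (M' - M) * (G.U \<sigma> (Suc j) r + of_bool (j = n - 1) * \<sigma> r)) has_integral w j r - w j x0) {x0..r}"
      by (simp add: w_def algebra_simps)
  qed (use that in \<open>auto simp: E_off\<close>)
  have jet: "is_jet x0 x1 n k a M w"
    unfolding is_jet_def
  proof (intro allI impI ballI)
    fix j r assume j: "j < n" and r: "r \<in> {x0..x1}"
    have int: "w j r = w j x0 + integral {x0..r} (E j)" if "r \<in> {x0..x1}" for r
      using integral_unique[OF w_integral[OF j that]] by simp
    have "((\<lambda>r. w j x0 + integral {x0..r} (E j)) has_vector_derivative 0 + E j r) (at r within {x0..x1})"
      by (intro has_vector_derivative_add has_vector_derivative_const
          integral_has_vector_derivative[OF E_cont r])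
    then have "(w j has_vector_derivative 0 + E j r) (at r within {x0..x1})"
      by (rule has_vector_derivative_transform[OF r, rotated]) (rule int)
    then show "(w j has_vector_derivative
        (if Suc j < n then w (Suc j) r else jet_rhs n k a M r (\<lambda>i. w i r))) (at r within {x0..x1})"
      by (simp add: E_def)
  qed
  have bdry: "(\<Sum>j<n. \<alpha> i j * w j x0 + \<beta> i j * w j x1) = 0" if i: "i \<in> {1..n}" for i
  proof -
    have "(\<Sum>j<n. \<alpha> i j * w j x0 + \<beta> i j * w j x1)
        = (\<Sum>j<n. \<alpha> i j * G'.D j x0 s + \<beta> i j * G'.D j x1 s)
          - (\<Sum>j<n. \<alpha> i j * G.D j x0 s + \<beta> i j * G.D j x1 s)
          + (M' - M) * (\<Sum>j<n. \<alpha> i j * G.U \<sigma> j x0 + \<beta> i j * G.U \<sigma> j x1)"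
      unfolding sum_distrib_left sum_subtractf[symmetric] sum.distrib[symmetric]
      using s by (intro sum.cong refl) (simp add: w_off algebra_simps)
    then show ?thesis
      using G.D_bdry[OF s i] G'.D_bdry[OF s i] U_bdry[OF i] by simp
  qed
  have "w l t = 0"
    by (rule jet_eq_0[OF G.ivl unique jet G.coef_cont G.k_less bdry l(1) t])
  moreover have "w l t = G'.D l t s - G.D l t s + (M' - M) * G.U \<sigma> l t"
    using l(2) w_off[of t l] by (cases "t = s") (auto simp: w_def G.R_low G'.R_low)
  ultimately show ?thesis
    by (simp add: \<sigma>_def[abs_def] algebra_simps)
qed

text \<open>
  A derivative of \<open>g'\<close> that vanished near the diagonal on both sides would make all higher ones
  vanish there, but the one of order \<open>n - 1\<close> jumps.
\<close>

lemma D'_not_locally_zero: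
  assumes s: "s \<in> {x0<..<x1}" and V: "open V" "s \<in> V" "V \<subseteq> {x0<..<x1}"
  shows "\<exists>r\<in>V - {s}. G'.D k r s \<noteq> 0"
proof (rule ccontr)
  assume "\<not> ?thesis"
  then have zero: "\<forall>r\<in>V - {s}. G'.D k r s = 0"
    by blast
  have "\<forall>r\<in>V - {s}. G'.D j r s = 0" if "k \<le> j" "j < n" for j
    using that
  proof (induction j rule: dec_induct)
    case base
    then show ?case
      using zero by blast
  next
    case (step j)
    show ?case
    proof
      fix r assume r: "r \<in> V - {s}"
      have "((\<lambda>r. G'.D j r s) has_real_derivative G'.D (Suc j) r s) (at r)"
        using step.prems r V s by (intro G'.D_deriv_interior) auto
      then have "((\<lambda>_. 0) has_real_derivative G'.D (Suc j) r s) (at r)"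
        by (rule has_field_derivative_transform_within_open[where S = "V - {s}"])
          (use V r step in \<open>auto intro: open_delete\<close>)
      then show "G'.D (Suc j) r s = 0"
        using DERIV_unique DERIV_const by blast
    qed
  qed
  then have top: "\<forall>r\<in>V - {s}. G'.D (n - 1) r s = 0"
    using G'.k_less by simp
  obtain p where p: "((\<lambda>r. G'.D (n - 1) r s) \<longlongrightarrow> p) (at_left s)"
    "((\<lambda>r. G'.D (n - 1) r s) \<longlongrightarrow> p + 1) (at_right s)"
    using G'.D_jump[OF s] .
  have ev: "eventually (\<lambda>r. r \<in> V - {s}) (at s)"
    using V by (intro eventually_at_in_open) auto
  have "eventually (\<lambda>r. G'.D (n - 1) r s = 0) (at s)"
    using ev by (rule eventually_mono) (use top in blast)
  then have "eventually (\<lambda>r. G'.D (n - 1) r s = 0) (at_left s)"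
    "eventually (\<lambda>r. G'.D (n - 1) r s = 0) (at_right s)"
    by (simp_all add: eventually_at_split)
  then have "((\<lambda>_. 0 :: real) \<longlongrightarrow> p) (at_left s)" "((\<lambda>_. 0 :: real) \<longlongrightarrow> p + 1) (at_right s)"
    using p by (blast intro: Lim_transform_eventually)+
  then have "p = 0" "p + 1 = 0"
    using tendsto_unique[OF trivial_limit_at_left_real _ tendsto_const]
      tendsto_unique[OF trivial_limit_at_right_real _ tendsto_const] by metis+
  then show False
    by simp
qed

text \<open>
  If the nonnegative integrand has integral zero, it is zero almost everywhere. Where
  \<open>D\<^sup>l g (t, r) \<noteq> 0\<close>, the second factor then vanishes almost everywhere, and by continuity
  everywhere off \<open>s\<close>.
\<close>

lemma overlap_sign:
  assumes s: "s \<in> {x0<..<x1}" and t: "t \<in> {x0<..<x1}" and l: "l < n" "l = n - 1 \<longrightarrow> t \<noteq> s"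
    and sign: "\<And>r. r \<in> {x0<..<x1} \<Longrightarrow> r \<noteq> t \<Longrightarrow> r \<noteq> s \<Longrightarrow> 0 \<le> G.D l t r * G'.D k r s"
  shows "0 \<le> overlap l t s" and "overlap l t s = 0 \<Longrightarrow> G.D l t s = 0"
proof -
  obtain C where "\<And>r s. \<bar>G'.K k r s\<bar> \<le> C"
    using K'_bounded by blast
  then have int: "integrable lborel (\<lambda>r. G.K l t r * G'.K k r s)"
    using l by (intro G.K_mult_integrable[OF K'_measurable]) auto
  have nonneg: "0 \<le> G.K l t r * G'.K k r s" for r
    using sign[of r] by (auto simp: G.K_def G'.K_def)
  then show "0 \<le> overlap l t s"
    by (simp add: G.U_def)
  assume "overlap l t s = 0"
  then have AE0: "AE r in lborel. G.K l t r * G'.K k r s = 0"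
    using integral_nonneg_eq_0_iff_AE[OF int] nonneg by (simp add: G.U_def)
  show "G.D l t s = 0"
  proof (rule ccontr)
    assume nz: "G.D l t s \<noteq> 0"
    \<comment> \<open>An open set on which \<open>G.D l t\<close> is continuous; for \<open>t = s\<close> it has to contain the diagonal
      point, where continuity is available because \<open>l < n - 1\<close>.\<close>
    define A where "A = (if t = s then {x0<..<x1} else {x0<..<x1} - {t})"
    have A: "open A" "s \<in> A" "A \<subseteq> {x0<..<x1}"
      using s by (auto simp: A_def open_delete)
    have "continuous_on A (G.D l t)"
    proof (cases "t = s")
      case True
      then have "l + 2 \<le> n"
        using l by auto
      then show ?thesis
        using t A by (intro continuous_on_subset[OF G.D_cont_snd]) auto
    next
      case False
      then show ?thesis
        using t l by (intro G.D_cont_snd_off) (auto simp: A_def)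
    qed
    define V where "V = G.D l t -` (- {0}) \<inter> A"
    have "open V"
      unfolding V_def using continuous_on_open_vimage[OF A(1), of "G.D l t"] \<open>continuous_on A (G.D l t)\<close>
      by (metis closed_singleton open_Compl)
    then have V: "open V" "s \<in> V" "V \<subseteq> A"
      using A nz by (auto simp: V_def)
    define Z where "Z = (\<lambda>r. G'.D k r s) -` (- {0}) \<inter> (V - {s})"
    have "continuous_on (V - {s}) (\<lambda>r. G'.D k r s)"
      using G'.k_less s V A by (intro G'.D_cont_fst_off) auto
    then have "open Z"
      unfolding Z_def using continuous_on_open_vimage[of "V - {s}" "\<lambda>r. G'.D k r s"] V
      by (metis closed_singleton open_Compl open_delete)
    have "G.K l t r * G'.K k r s \<noteq> 0" if "r \<in> Z" for r
      using that V A s t by (auto simp: Z_def V_def A_def G.K_def G'.K_def split: if_splits)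
    then have "AE r in lborel. r \<notin> Z"
      using AE0 by (auto elim: eventually_mono)
    then have "Z \<in> null_sets lborel"
      using AE_iff_null_sets[of Z lborel] \<open>open Z\<close> by simp
    then have "negligible Z"
      by (simp add: negligible_iff_null_sets null_sets_completionI)
    then have "Z = {}"
      using open_not_negligible \<open>open Z\<close> by blast
    then show False
      using D'_not_locally_zero[OF s V(1,2)] V A unfolding Z_def by blast
  qed
qed

lemma comparison:
  assumes s: "s \<in> {x0<..<x1}" and t: "t \<in> {x0<..<x1}" and l: "l < n" "l = n - 1 \<longrightarrow> t \<noteq> s"
    and sign: "pderiv_nonneg x0 x1 n l g \<and> pderiv_nonneg x0 x1 n k g' \<or>
      pderiv_nonpos x0 x1 n l g \<and> pderiv_nonpos x0 x1 n k g'"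
  shows "\<exists>\<Delta>\<ge>0. G'.D l t s - G.D l t s = (M - M') * \<Delta> \<and> (\<Delta> = 0 \<longrightarrow> G.D l t s = 0)"
proof -
  have "0 \<le> G.D l t r * G'.D k r s" if "r \<in> {x0<..<x1}" "r \<noteq> t" "r \<noteq> s" for r
    using sign
  proof
    assume "pderiv_nonneg x0 x1 n l g \<and> pderiv_nonneg x0 x1 n k g'"
    then show ?thesis
      using that s t by (intro mult_nonneg_nonneg) (auto simp: pderiv_nonneg_def)
  next
    assume "pderiv_nonpos x0 x1 n l g \<and> pderiv_nonpos x0 x1 n k g'"
    then show ?thesis
      using that s t by (intro mult_nonpos_nonpos) (auto simp: pderiv_nonpos_def)
  qed
  note overlap = overlap_sign[OF s t l this]
  show ?thesis
    using overlap representation[OF s _ l] t by (intro exI[of _ "overlap l t s"]) auto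
qed

end

theorem theorem2p6:
  fixes x0 x1 M0 M1 t s :: real
    and n k l :: nat
    and a :: "nat \<Rightarrow> real \<Rightarrow> real"
    and \<alpha> \<beta> :: "nat \<Rightarrow> nat \<Rightarrow> real"
    and g0 g1 :: "real \<Rightarrow> real \<Rightarrow> real"
  assumes "x0 < x1"
    and "\<forall>j\<in>{1..n}. continuous_on {x0..x1} (a j)"
    and "k \<in> {0..<n}" and "l \<in> {0..<n}"
    and "M0 < M1"
    and "bvp_unique x0 x1 n k a \<alpha> \<beta> M0" and "bvp_unique x0 x1 n k a \<alpha> \<beta> M1"
    and "is_green x0 x1 n k a \<alpha> \<beta> M0 g0" and "is_green x0 x1 n k a \<alpha> \<beta> M1 g1"
    and "hyp_H x0 x1 n k l a M0" and "hyp_H x0 x1 n k l a M1"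
    and "t \<in> {x0<..<x1}" and "s \<in> {x0<..<x1}" and "l = n - 1 \<longrightarrow> t \<noteq> s"
    and "(pderiv_nonneg x0 x1 n l g0 \<and> pderiv_nonneg x0 x1 n k g1 \<or>
          pderiv_nonpos x0 x1 n l g0 \<and> pderiv_nonpos x0 x1 n k g1) \<or>
         (pderiv_nonneg x0 x1 n l g1 \<and> pderiv_nonneg x0 x1 n k g0 \<or>
          pderiv_nonpos x0 x1 n l g1 \<and> pderiv_nonpos x0 x1 n k g0)"
  shows "(t \<in> {x0..s} \<and> pderiv_t x0 x1 l g1 t s = 0 \<and> pderiv_t x0 x1 l g0 t s = 0) \<or>
         (t \<in> {s..x1} \<and> pderiv_t x0 x1 l g1 t s = 0 \<and> pderiv_t x0 x1 l g0 t s = 0) \<or>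
         pderiv_t x0 x1 l g1 t s < pderiv_t x0 x1 l g0 t s"
proof -
  have G0: "green_function x0 x1 n k a \<alpha> \<beta> M0 g0" and G1: "green_function x0 x1 n k a \<alpha> \<beta> M1 g1"
    unfolding green_function_def using assms(1-3,8,9) by simp_all
  interpret P01: green_pair x0 x1 n k a \<alpha> \<beta> M0 g0 M1 g1
    using G0 G1 assms(6) by (simp add: green_pair_def green_pair_axioms_def)
  interpret P10: green_pair x0 x1 n k a \<alpha> \<beta> M1 g1 M0 g0
    using G0 G1 assms(7) by (simp add: green_pair_def green_pair_axioms_def)
  define d0 d1 where "d0 = pderiv_t x0 x1 l g0 t s" and "d1 = pderiv_t x0 x1 l g1 t s"
  have l: "l < n"
    using assms by simp
  obtain \<Delta> where \<Delta>: "0 \<le> \<Delta>" "d0 - d1 = (M1 - M0) * \<Delta>" "\<Delta> = 0 \<Longrightarrow> d0 = 0 \<or> d1 = 0"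
    using assms(15)
  proof
    assume "pderiv_nonneg x0 x1 n l g0 \<and> pderiv_nonneg x0 x1 n k g1 \<or>
      pderiv_nonpos x0 x1 n l g0 \<and> pderiv_nonpos x0 x1 n k g1"
    from P01.comparison[OF assms(13) assms(12) l assms(14) this]
    obtain \<Delta> where "0 \<le> \<Delta>" "d1 - d0 = (M0 - M1) * \<Delta>" "\<Delta> = 0 \<longrightarrow> d0 = 0"
      unfolding d0_def d1_def by blast
    then show ?thesis
      by (intro that[of \<Delta>]) (auto simp: algebra_simps)
  next
    assume "pderiv_nonneg x0 x1 n l g1 \<and> pderiv_nonneg x0 x1 n k g0 \<or>
      pderiv_nonpos x0 x1 n l g1 \<and> pderiv_nonpos x0 x1 n k g0"
    from P10.comparison[OF assms(13) assms(12) l assms(14) this]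
    obtain \<Delta> where "0 \<le> \<Delta>" "d0 - d1 = (M1 - M0) * \<Delta>" "\<Delta> = 0 \<longrightarrow> d1 = 0"
      unfolding d0_def d1_def by blast
    then show ?thesis
      by (intro that[of \<Delta>]) auto
  qed
  have "d1 < d0 \<or> d0 = 0 \<and> d1 = 0"
  proof (cases "\<Delta> = 0")
    case True
    then show ?thesis
      using \<Delta> by auto
  next
    case False
    then have "0 < (M1 - M0) * \<Delta>"
      using \<Delta>(1) \<open>M0 < M1\<close> by simp
    then show ?thesis
      using \<Delta>(2) by linarith
  qed
  then show ?thesis
    using assms(12,13) unfolding d0_def d1_def by auto
qed

end
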